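(* Let $\varphi:X\to Y$ be a dominant morphism between normal affine varieties, and regard $\mathcal{O}(Y)\subseteq\mathcal{O}(X)$ via $\varphi$. Assume $\mathcal{D}(X)$ contains a graded cofinite subalgebra $\mathcal{A}$ with $\mathcal{A}\cap\mathcal{O}(X)=\mathcal{O}(Y)$. Then $\varphi$ is uniformly ramified.
   Context: Varieties are over $\mathbb{C}$ and irreducible. $\mathcal{D}(X)$ is the algebra of ($\mathbb{C}$-linear, Grothendieck) differential operators on $\mathcal{O}(X)$, filtered by order, with commutative associated graded algebra $\overline{\mathcal{D}}(X)$. A subalgebra $\mathcal{A}$ has induced filtration $\mathcal{A}\cap\mathcal{D}(X)_{\le d}$ with associated graded $\overline{\mathcal{A}}\subseteq\overline{\mathcal{D}}(X)$; $\mathcal{A}$ is graded cofinite if $\overline{\mathcal{D}}(X)$ is a finitely generated $\overline{\mathcal{A}}$-module. A morphism $\varphi:X\to Y$ of normal varieties is uniformly ramified if it is finite and surjective and for every prime divisor $D\subseteq Y$, writing $\varphi^{-1}(D)=r_1E_1+\cdots+r_sE_s$ with distinct prime divisors $E_i$, one has $r_1=\cdots=r_s$. *)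

theory Defs
  imports Complex_Main
begin

text \<open>The coordinate ring O(X) of an affine variety over C is modelled as a type 'x
  (an integral domain, X being irreducible) together with an embedding of C.\<close>

definition is_C_embedding :: "(complex \<Rightarrow> 'x::idom) \<Rightarrow> bool" where
  "is_C_embedding c \<longleftrightarrow> inj c \<and> c 0 = 0 \<and> c 1 = 1 \<and>
     (\<forall>a b. c (a + b) = c a + c b) \<and> (\<forall>a b. c (a * b) = c a * c b)"

inductive_set alg_gen :: "(complex \<Rightarrow> 'x::comm_ring_1) \<Rightarrow> 'x set \<Rightarrow> 'x set"
  for c :: "complex \<Rightarrow> 'x" and G :: "'x set" where
  scalar: "c z \<in> alg_gen c G"
| gen: "g \<in> G \<Longrightarrow> g \<in> alg_gen c G"
| add: "a \<in> alg_gen c G \<Longrightarrow> b \<in> alg_gen c G \<Longrightarrow> a + b \<in> alg_gen c G"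
| mult: "a \<in> alg_gen c G \<Longrightarrow> b \<in> alg_gen c G \<Longrightarrow> a * b \<in> alg_gen c G"

definition C_subalgebra :: "(complex \<Rightarrow> 'x::comm_ring_1) \<Rightarrow> 'x set \<Rightarrow> bool" where
  "C_subalgebra c S \<longleftrightarrow> range c \<subseteq> S \<and>
     (\<forall>a\<in>S. \<forall>b\<in>S. a + b \<in> S \<and> a * b \<in> S)"

definition fg_C_algebra :: "(complex \<Rightarrow> 'x::comm_ring_1) \<Rightarrow> 'x set \<Rightarrow> bool" where
  "fg_C_algebra c S \<longleftrightarrow> (\<exists>G. finite G \<and> alg_gen c G = S)"

text \<open>A subdomain S is normal: integrally closed in its field of fractions.
  The fraction a/b (a, b in S, b nonzero) is integral over S iff a monic relation
  a^n + sum_{i<n} c_i a^i b^(n-i) = 0 holds with c_i in S; it lies in S iff b divides a in S.\<close>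
definition normal_domain :: "'x::idom set \<Rightarrow> bool" where
  "normal_domain S \<longleftrightarrow>
     (\<forall>a\<in>S. \<forall>b\<in>S. b \<noteq> 0 \<longrightarrow>
        (\<exists>n cs. (\<forall>i<n. cs i \<in> S) \<and> a ^ n + (\<Sum>i<n. cs i * a ^ i * b ^ (n - i)) = 0) \<longrightarrow>
        (\<exists>s\<in>S. a = b * s))"

definition C_linear :: "(complex \<Rightarrow> 'x::comm_ring_1) \<Rightarrow> ('x \<Rightarrow> 'x) \<Rightarrow> bool" where
  "C_linear c \<theta> \<longleftrightarrow> (\<forall>f g. \<theta> (f + g) = \<theta> f + \<theta> g) \<and> (\<forall>z f. \<theta> (c z * f) = c z * \<theta> f)"

fun diffop_le :: "(complex \<Rightarrow> 'x::comm_ring_1) \<Rightarrow> nat \<Rightarrow> ('x \<Rightarrow> 'x) \<Rightarrow> bool" where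
  "diffop_le c 0 \<theta> \<longleftrightarrow> C_linear c \<theta> \<and> (\<forall>f g. \<theta> (f * g) = f * \<theta> g)"
| "diffop_le c (Suc n) \<theta> \<longleftrightarrow> C_linear c \<theta> \<and> (\<forall>f. diffop_le c n (\<lambda>g. \<theta> (f * g) - f * \<theta> g))"

definition diff_ops :: "(complex \<Rightarrow> 'x::comm_ring_1) \<Rightarrow> ('x \<Rightarrow> 'x) set" where
  "diff_ops c = {\<theta>. \<exists>n. diffop_le c n \<theta>}"

definition diffop_lt :: "(complex \<Rightarrow> 'x::comm_ring_1) \<Rightarrow> nat \<Rightarrow> ('x \<Rightarrow> 'x) \<Rightarrow> bool" where
  "diffop_lt c d \<theta> = (case d of 0 \<Rightarrow> \<theta> = (\<lambda>_. 0) | Suc n \<Rightarrow> diffop_le c n \<theta>)"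

definition mult_op :: "'x::comm_ring_1 \<Rightarrow> ('x \<Rightarrow> 'x)" where
  "mult_op f = (\<lambda>g. f * g)"

definition D_subalgebra :: "(complex \<Rightarrow> 'x::comm_ring_1) \<Rightarrow> ('x \<Rightarrow> 'x) set \<Rightarrow> bool" where
  "D_subalgebra c A \<longleftrightarrow> A \<subseteq> diff_ops c \<and> id \<in> A \<and>
     (\<forall>\<theta>\<in>A. \<forall>\<eta>\<in>A. (\<lambda>g. \<theta> g + \<eta> g) \<in> A \<and> \<theta> \<circ> \<eta> \<in> A) \<and>
     (\<forall>z. \<forall>\<theta>\<in>A. (\<lambda>g. c z * \<theta> g) \<in> A)"

text \<open>Graded cofinite: gr D(X) is a finitely generated module over gr A (induced filtration).
  Unfolded: there are finitely many homogeneous generators sigma_{dj j}(s j) such that,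
  in every degree d, gr_d D(X) = sum_j sigma_{d - dj j}(gr A) * sigma_{dj j}(s j); i.e. every
  operator theta of order <= d agrees modulo D_{<= d-1} with sum_j a_j o s_j, where
  a_j in A has order <= d - dj j (and a_j = 0 when dj j > d).\<close>
definition graded_cofinite :: "(complex \<Rightarrow> 'x::comm_ring_1) \<Rightarrow> ('x \<Rightarrow> 'x) set \<Rightarrow> bool" where
  "graded_cofinite c A \<longleftrightarrow>
     (\<exists>(J::nat set) s dj. finite J \<and> (\<forall>j\<in>J. diffop_le c (dj j) (s j)) \<and>
        (\<forall>d \<theta>. diffop_le c d \<theta> \<longrightarrow>
           (\<exists>a. (\<forall>j\<in>J. a j \<in> A \<and> (dj j \<le> d \<longrightarrow> diffop_le c (d - dj j) (a j))
                        \<and> (d < dj j \<longrightarrow> a j = (\<lambda>_. 0))) \<and>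
                diffop_lt c d (\<lambda>g. \<theta> g - (\<Sum>j\<in>J. a j (s j g))))))"

definition ideal_in :: "'x::comm_ring_1 set \<Rightarrow> 'x set \<Rightarrow> bool" where
  "ideal_in S I \<longleftrightarrow> I \<subseteq> S \<and> 0 \<in> I \<and> (\<forall>a\<in>I. \<forall>b\<in>I. a + b \<in> I) \<and> (\<forall>a\<in>I. \<forall>s\<in>S. s * a \<in> I)"

definition prime_in :: "'x::comm_ring_1 set \<Rightarrow> 'x set \<Rightarrow> bool" where
  "prime_in S P \<longleftrightarrow> ideal_in S P \<and> 1 \<notin> P \<and> (\<forall>a\<in>S. \<forall>b\<in>S. a * b \<in> P \<longrightarrow> a \<in> P \<or> b \<in> P)"

definition maximal_in :: "'x::comm_ring_1 set \<Rightarrow> 'x set \<Rightarrow> bool" where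
  "maximal_in S m \<longleftrightarrow> ideal_in S m \<and> 1 \<notin> m \<and>
     (\<forall>I. ideal_in S I \<and> m \<subseteq> I \<longrightarrow> I = m \<or> 1 \<in> I)"

definition height_one_in :: "'x::idom set \<Rightarrow> 'x set \<Rightarrow> bool" where
  "height_one_in S P \<longleftrightarrow> prime_in S P \<and> P \<noteq> {0} \<and>
     \<not> (\<exists>Q. prime_in S Q \<and> {0} \<subset> Q \<and> Q \<subset> P)"

inductive in_ideal_power :: "'x::comm_ring_1 set \<Rightarrow> nat \<Rightarrow> 'x \<Rightarrow> bool"
  for Q :: "'x set" where
  zero: "in_ideal_power Q 0 x"
| prod: "q \<in> Q \<Longrightarrow> in_ideal_power Q n y \<Longrightarrow> in_ideal_power Q (Suc n) (q * y)"
| sum: "in_ideal_power Q n x \<Longrightarrow> in_ideal_power Q n y \<Longrightarrow> in_ideal_power Q n (x + y)"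

text \<open>Symbolic power Q^(n) = Q^n R_Q intersected with R; for a height-one prime Q of a normal
  domain this is {f. v_Q(f) >= n}.\<close>
definition symbolic_power :: "'x::comm_ring_1 set \<Rightarrow> nat \<Rightarrow> 'x set" where
  "symbolic_power Q n = {x. \<exists>s. s \<notin> Q \<and> in_ideal_power Q n (s * x)}"

text \<open>Multiplicity r of the prime divisor E = V(Q) in the pullback of D = V(P):
  r = min_{p in P} v_Q(p) = greatest n with P contained in Q^(n).\<close>
definition ramification_index :: "'x::comm_ring_1 set \<Rightarrow> 'x set \<Rightarrow> nat" where
  "ramification_index P Q = (GREATEST n. P \<subseteq> symbolic_power Q n)"

text \<open>phi : X \<rightarrow> Y given by the inclusion S = O(Y) \<subseteq> O(X) = UNIV.\<close>
definition finite_morphism :: "'x::comm_ring_1 set \<Rightarrow> bool" where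
  "finite_morphism S \<longleftrightarrow> (\<exists>F. finite F \<and> (\<forall>r. \<exists>co. (\<forall>f\<in>F. co f \<in> S) \<and> r = (\<Sum>f\<in>F. co f * f)))"

definition surjective_morphism :: "'x::comm_ring_1 set \<Rightarrow> bool" where
  "surjective_morphism S \<longleftrightarrow>
     (\<forall>m. maximal_in S m \<longrightarrow> (\<exists>M. maximal_in UNIV M \<and> M \<inter> S = m))"

definition uniformly_ramified :: "'x::idom set \<Rightarrow> bool" where
  "uniformly_ramified S \<longleftrightarrow> finite_morphism S \<and> surjective_morphism S \<and>
     (\<forall>P. height_one_in S P \<longrightarrow>
        (\<forall>Q1 Q2. height_one_in UNIV Q1 \<longrightarrow> height_one_in UNIV Q2 \<longrightarrow>
           Q1 \<inter> S = P \<longrightarrow> Q2 \<inter> S = P \<longrightarrow>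
           ramification_index P Q1 = ramification_index P Q2))"

end

theory Submission
  imports Defs "HOL-Computational_Algebra.Polynomial"
begin

text \<open>Let \<open>R = O(X)\<close>, \<open>S = O(Y)\<close>. Finiteness of \<open>R\<close> over \<open>S\<close> is the degree-zero part of graded
  cofiniteness. For the ramification, let \<open>y\<close> be a uniformizer of \<open>S\<close> at \<open>P\<close> and suppose that
  \<open>v\<^sub>1(y) = r\<^sub>1 < r\<^sub>2 = v\<^sub>2(y)\<close> for two height-one primes \<open>Q\<^sub>1\<close>, \<open>Q\<^sub>2\<close> of \<open>R\<close> over \<open>P\<close>. For \<open>a\<close> in \<open>A\<close> of
  order \<open>\<le> m\<close> the symbol \<open>ad(y)^m a\<close> lies in \<open>A \<inter> R = S\<close>. Its value at \<open>Q\<^sub>2\<close> is at least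
  \<open>m (r\<^sub>2 - 1)\<close>, because \<open>dy\<close> is divisible by \<open>x\<^sub>2^(r\<^sub>2 - 1)\<close>; as an element of \<open>S\<close> its values at
  \<open>Q\<^sub>1\<close> and \<open>Q\<^sub>2\<close> are in the ratio \<open>r\<^sub>1 : r\<^sub>2\<close>, so its value at \<open>Q\<^sub>1\<close> exceeds \<open>m (r\<^sub>1 - 1)\<close>. Hence
  \<open>ad(x\<^sub>1)^m a\<close> lies in \<open>Q\<^sub>1\<close> for all \<open>m > 0\<close>. Take a derivation \<open>\<delta>\<close> of \<open>R\<close> with \<open>\<delta> x\<^sub>1\<close> outside
  \<open>Q\<^sub>1\<close>. Writing \<open>\<delta>^n\<close>, modulo lower order, in terms of the finitely many module generators,
  with \<open>n\<close> larger than their degrees, and applying \<open>ad(x\<^sub>1)^n\<close> gives \<open>n! (\<delta> x\<^sub>1)^n \<in> Q\<^sub>1\<close>, a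
  contradiction.\<close>

subsection \<open>Noetherian subrings\<close>

text \<open>Subrings are carrier sets inside one type, so that \<open>S\<close>, the intermediate
  algebras and the whole ring \<open>UNIV\<close> share the same facts.\<close>

locale unital_subring =
  fixes S :: "'x::idom set"
  assumes one_mem: "1 \<in> S"
    and add_mem: "a \<in> S \<Longrightarrow> b \<in> S \<Longrightarrow> a + b \<in> S"
    and mult_mem: "a \<in> S \<Longrightarrow> b \<in> S \<Longrightarrow> a * b \<in> S"
    and uminus_mem: "a \<in> S \<Longrightarrow> - a \<in> S"
begin

lemma zero_mem: "0 \<in> S"
  using add_mem[OF one_mem uminus_mem[OF one_mem]] by simp

lemma diff_mem: "a \<in> S \<Longrightarrow> b \<in> S \<Longrightarrow> a - b \<in> S"
  using add_mem[of a "- b"] uminus_mem[of b] by simp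

lemma power_mem: "a \<in> S \<Longrightarrow> a ^ n \<in> S"
  by (induction n) (auto intro: one_mem mult_mem)

lemma sum_mem: "(\<And>i. i \<in> I \<Longrightarrow> f i \<in> S) \<Longrightarrow> sum f I \<in> S"
  by (induction I rule: infinite_finite_induct) (auto intro: zero_mem add_mem)

lemma of_nat_mem: "of_nat n \<in> S"
  by (induction n) (auto intro: zero_mem one_mem add_mem)

end

lemma unital_subring_UNIV: "unital_subring UNIV"
  by unfold_locales auto

definition ideal_gen :: "'x::comm_ring_1 set \<Rightarrow> 'x set \<Rightarrow> 'x set" where
  "ideal_gen S B = \<Inter> {I. ideal_in S I \<and> B \<subseteq> I}"

definition noetherian_set :: "'x::comm_ring_1 set \<Rightarrow> bool" where
  "noetherian_set S \<longleftrightarrow>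
     (\<forall>I. ideal_in S I \<longrightarrow> (\<exists>B. finite B \<and> B \<subseteq> I \<and> I \<subseteq> ideal_gen S B))"

lemma ideal_in_sum:
  assumes "ideal_in S I" "\<And>i. i \<in> X \<Longrightarrow> f i \<in> I"
  shows "sum f X \<in> I"
  using assms(2) assms(1)
  by (induction X rule: infinite_finite_induct) (auto simp: ideal_in_def)

lemma ideal_in_mult: "ideal_in S I \<Longrightarrow> a \<in> I \<Longrightarrow> s \<in> S \<Longrightarrow> s * a \<in> I"
  by (auto simp: ideal_in_def)

lemma ideal_in_add: "ideal_in S I \<Longrightarrow> a \<in> I \<Longrightarrow> b \<in> I \<Longrightarrow> a + b \<in> I"
  by (auto simp: ideal_in_def)

lemma ideal_gen_least: "ideal_in S I \<Longrightarrow> B \<subseteq> I \<Longrightarrow> ideal_gen S B \<subseteq> I"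
  by (auto simp: ideal_gen_def)

lemma ideal_gen_superset: "B \<subseteq> ideal_gen S B"
  by (auto simp: ideal_gen_def)

lemma ideal_gen_mono: "B \<subseteq> C \<Longrightarrow> ideal_gen S B \<subseteq> ideal_gen S C"
  by (auto simp: ideal_gen_def)

context unital_subring begin

lemma ideal_in_self: "ideal_in S S"
  by (auto simp: ideal_in_def zero_mem add_mem mult_mem)

lemma ideal_gen_ideal:
  assumes "B \<subseteq> S" shows "ideal_in S (ideal_gen S B)"
proof -
  have "ideal_gen S B \<subseteq> S" by (rule ideal_gen_least[OF ideal_in_self assms])
  then show ?thesis unfolding ideal_in_def by (auto simp: ideal_gen_def ideal_in_def)
qed

lemma ideal_uminus: "ideal_in S I \<Longrightarrow> a \<in> I \<Longrightarrow> - a \<in> I"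
  using ideal_in_mult[of S I a "- 1"] uminus_mem[OF one_mem] by simp

lemma lincomb_ideal:
  assumes "\<And>i. i < (N::nat) \<Longrightarrow> e i \<in> S"
  shows "ideal_in S {\<Sum>i<N. k i * e i | k. \<forall>i<N. k i \<in> S}"
  unfolding ideal_in_def
proof (intro conjI ballI)
  let ?L = "{\<Sum>i<N. k i * e i | k. \<forall>i<N. k i \<in> S}"
  show "?L \<subseteq> S" using assms by (auto intro!: sum_mem mult_mem)
  show "0 \<in> ?L" by (auto intro!: exI[of _ "\<lambda>_. 0"] simp: zero_mem)
next
  fix a b assume "a \<in> {\<Sum>i<N. k i * e i | k. \<forall>i<N. k i \<in> S}"
    "b \<in> {\<Sum>i<N. k i * e i | k. \<forall>i<N. k i \<in> S}"
  then obtain k l where "a = (\<Sum>i<N. k i * e i)" "\<forall>i<N. k i \<in> S"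
    "b = (\<Sum>i<N. l i * e i)" "\<forall>i<N. l i \<in> S" by auto
  then show "a + b \<in> {\<Sum>i<N. k i * e i | k. \<forall>i<N. k i \<in> S}"
    by (auto intro!: exI[of _ "\<lambda>i. k i + l i"] simp: add_mem distrib_right sum.distrib)
next
  fix a s assume "a \<in> {\<Sum>i<N. k i * e i | k. \<forall>i<N. k i \<in> S}" "s \<in> S"
  then obtain k where "a = (\<Sum>i<N. k i * e i)" "\<forall>i<N. k i \<in> S" by auto
  then show "s * a \<in> {\<Sum>i<N. k i * e i | k. \<forall>i<N. k i \<in> S}"
    using \<open>s \<in> S\<close> by (auto intro!: exI[of _ "\<lambda>i. s * k i"] simp: mult_mem sum_distrib_left mult.assoc)
qed

lemma ideal_gen_lincomb:
  assumes "\<And>i. i < (N::nat) \<Longrightarrow> e i \<in> S" "x \<in> ideal_gen S (e ` {..<N})"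
  shows "\<exists>k. (\<forall>i<N. k i \<in> S) \<and> x = (\<Sum>i<N. k i * e i)"
proof -
  have "e ` {..<N} \<subseteq> {\<Sum>i<N. k i * e i | k. \<forall>i<N. k i \<in> S}"
  proof (rule image_subsetI)
    fix j assume "j \<in> {..<N}"
    then have "e j = (\<Sum>i<N. (if i = j then 1 else 0) * e i)"
      by (simp add: if_distrib[of "\<lambda>x. x * _"] sum.delta cong: if_cong)
    then show "e j \<in> {\<Sum>i<N. k i * e i | k. \<forall>i<N. k i \<in> S}"
      using one_mem zero_mem by fastforce
  qed
  with ideal_gen_least[OF lincomb_ideal[of N e]] assms show ?thesis by blast
qed

lemma chain_Union_ideal:
  assumes "\<C> \<noteq> {}" "\<And>I. I \<in> \<C> \<Longrightarrow> ideal_in S I"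
    "\<And>I J. I \<in> \<C> \<Longrightarrow> J \<in> \<C> \<Longrightarrow> I \<subseteq> J \<or> J \<subseteq> I"
  shows "ideal_in S (\<Union>\<C>)"
  unfolding ideal_in_def
proof (intro conjI ballI)
  show "\<Union>\<C> \<subseteq> S" using assms(2) unfolding ideal_in_def by blast
  show "0 \<in> \<Union>\<C>" using assms(1,2) by (auto simp: ideal_in_def)
next
  fix a b assume "a \<in> \<Union>\<C>" "b \<in> \<Union>\<C>"
  then obtain I J where "I \<in> \<C>" "J \<in> \<C>" "a \<in> I" "b \<in> J" by auto
  then show "a + b \<in> \<Union>\<C>" using assms(2,3)[of I] assms(2)[of J] assms(3)[of I J]
    by (metis (full_types) UnionI ideal_in_add subsetD)
next
  fix a s assume "a \<in> \<Union>\<C>" "s \<in> S"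
  then show "s * a \<in> \<Union>\<C>" using assms(2) by (auto intro: ideal_in_mult)
qed

text \<open>A finite generating set of the union of a chain already lies in one member, so the union
  is itself a member and Zorn's lemma applies.\<close>

lemma noetherian_maximal:
  assumes "noetherian_set S" "\<F> \<noteq> {}" "\<And>I. I \<in> \<F> \<Longrightarrow> ideal_in S I"
  shows "\<exists>M\<in>\<F>. \<forall>J\<in>\<F>. M \<subseteq> J \<longrightarrow> J = M"
proof (rule subset_Zorn_nonempty[OF assms(2)])
  fix \<C> assume C: "\<C> \<noteq> {}" "subset.chain \<F> \<C>"
  then have CF: "\<C> \<subseteq> \<F>" and lin: "\<And>I J. I \<in> \<C> \<Longrightarrow> J \<in> \<C> \<Longrightarrow> I \<subseteq> J \<or> J \<subseteq> I"
    by (auto simp: subset_chain_def)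
  have "ideal_in S (\<Union>\<C>)"
    using chain_Union_ideal[OF C(1)] CF lin assms(3) by blast
  then obtain B where B: "finite B" "B \<subseteq> \<Union>\<C>" "\<Union>\<C> \<subseteq> ideal_gen S B"
    using assms(1) by (auto simp: noetherian_set_def)
  obtain I where I: "I \<in> \<C>" "B \<subseteq> I"
    using finite_subset_Union_chain[OF B(1,2) C(1)] C(2) by blast
  then have "ideal_gen S B \<subseteq> I" using CF assms(3) by (intro ideal_gen_least) auto
  then have "\<Union>\<C> = I" using I B by blast
  then show "\<Union>\<C> \<in> \<F>" using I CF by auto
qed

text \<open>The ideals generated by initial segments stabilise, and \<open>N\<close> is an index at
  which the next term adds nothing.\<close>

lemma noetherian_sequence:
  fixes e :: "nat \<Rightarrow> 'x"
  assumes "noetherian_set S" "\<And>n. e n \<in> S"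
  shows "\<exists>N k. (\<forall>i<N. k i \<in> S) \<and> e N = (\<Sum>i<N. k i * e i)"
proof -
  let ?I = "\<lambda>n. ideal_gen S (e ` {..<n})"
  have "\<exists>M\<in>range ?I. \<forall>J\<in>range ?I. M \<subseteq> J \<longrightarrow> J = M"
    using assms by (intro noetherian_maximal) (auto intro!: ideal_gen_ideal)
  then obtain N where N: "\<forall>n. ?I N \<subseteq> ?I n \<longrightarrow> ?I n = ?I N" by auto
  have "?I N \<subseteq> ?I (Suc N)" by (intro ideal_gen_mono) auto
  with N have "?I (Suc N) = ?I N" by blast
  moreover have "e N \<in> ?I (Suc N)" using ideal_gen_superset by (rule subsetD) auto
  ultimately show ?thesis using ideal_gen_lincomb[of N e "e N"] assms(2) by metis
qed

end

text \<open>Dependent choice, by well-founded recursion, in which each term is constrained by the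
  finite set of all earlier ones.\<close>

lemma sequence_by_finite_choice:
  assumes "\<And>B. finite B \<Longrightarrow> B \<subseteq> X \<Longrightarrow> \<exists>x\<in>X. R B x"
  obtains e :: "nat \<Rightarrow> 'a" where "\<And>n. e n \<in> X \<and> R (e ` {..<n}) (e n)"
proof -
  define e :: "nat \<Rightarrow> 'a" where "e = wfrec less_than (\<lambda>e n. SOME x. x \<in> X \<and> R (e ` {..<n}) x)"
  have e: "e n = (SOME x. x \<in> X \<and> R (e ` {..<n}) x)" for n
  proof -
    have "cut e less_than n ` {..<n} = e ` {..<n}"
      by (intro image_cong) (auto simp: cut_apply)
    then show ?thesis unfolding e_def by (subst wfrec) auto
  qed
  have "e n \<in> X \<and> R (e ` {..<n}) (e n)" for n
  proof (induction n rule: less_induct)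
    case (less n)
    then have "\<exists>x. x \<in> X \<and> R (e ` {..<n}) x" using assms[of "e ` {..<n}"] by auto
    then show ?case unfolding e[of n] by (rule someI_ex)
  qed
  then show ?thesis using that by blast
qed

section \<open>Hilbert's basis theorem for simple ring extensions\<close>

definition adjoin :: "'x::comm_ring_1 set \<Rightarrow> 'x \<Rightarrow> 'x set" where
  "adjoin K t = {poly p t | p. \<forall>i. coeff p i \<in> K}"

context unital_subring begin

lemma coeff_mult_mem:
  "(\<forall>i. coeff p i \<in> S) \<Longrightarrow> (\<forall>i. coeff q i \<in> S) \<Longrightarrow> coeff (p * q) i \<in> S"
  by (auto simp: coeff_mult intro!: sum_mem mult_mem)

lemma coeff_sum_mem:
  "(\<And>j. j \<in> J \<Longrightarrow> coeff (f j) i \<in> S) \<Longrightarrow> coeff (sum f J) i \<in> S"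
  by (auto simp: coeff_sum intro!: sum_mem)

lemma coeff_monom_mem: "a \<in> S \<Longrightarrow> coeff (monom a n) i \<in> S"
  by (auto simp: zero_mem)

lemma adjoin_subring: "unital_subring (adjoin S t)"
proof
  show "1 \<in> adjoin S t" unfolding adjoin_def
    by (auto intro!: exI[of _ 1] simp: one_mem zero_mem)
  fix a assume "a \<in> adjoin S t"
  then obtain p where p: "a = poly p t" "\<forall>i. coeff p i \<in> S" by (auto simp: adjoin_def)
  show "- a \<in> adjoin S t" unfolding adjoin_def
    using p by (auto intro!: exI[of _ "- p"] simp: uminus_mem)
  fix b assume "b \<in> adjoin S t"
  then obtain q where q: "b = poly q t" "\<forall>i. coeff q i \<in> S" by (auto simp: adjoin_def)
  show "a + b \<in> adjoin S t" unfolding adjoin_def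
    using p q by (auto intro!: exI[of _ "p + q"] simp: add_mem)
  show "a * b \<in> adjoin S t" unfolding adjoin_def
    using p q by (auto intro!: exI[of _ "p * q"] coeff_mult_mem)
qed

lemma subset_adjoin: "S \<subseteq> adjoin S t"
proof
  fix a assume "a \<in> S"
  then show "a \<in> adjoin S t" unfolding adjoin_def
    by (auto intro!: exI[of _ "[:a:]"] simp: coeff_pCons zero_mem split: nat.split)
qed

lemma gen_mem_adjoin: "t \<in> adjoin S t"
  unfolding adjoin_def
  by (auto intro!: exI[of _ "[:0, 1:]"] simp: coeff_pCons zero_mem one_mem split: nat.split)

lemma adjoin_least:
  assumes "unital_subring T" "S \<subseteq> T" "t \<in> T"
  shows "adjoin S t \<subseteq> T"
proof -
  interpret T: unital_subring T by fact
  show ?thesis using assms(2,3)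
    by (auto simp: adjoin_def poly_altdef intro!: T.sum_mem T.mult_mem T.power_mem)
qed

text \<open>Hilbert's basis theorem: successive generators of minimal degree have leading
  coefficients that become dependent over the coefficient ring.\<close>
lemma noetherian_adjoin:
  assumes noeth: "noetherian_set S"
  shows "noetherian_set (adjoin S t)"
  unfolding noetherian_set_def
proof (intro allI impI, rule ccontr)
  let ?T = "adjoin S t"
  interpret T: unital_subring ?T by (rule adjoin_subring)
  fix I assume I: "ideal_in ?T I" and "\<nexists>B. finite B \<and> B \<subseteq> I \<and> I \<subseteq> ideal_gen ?T B"
  then have nfg: "\<exists>x\<in>I. x \<notin> ideal_gen ?T B" if "finite B" "B \<subseteq> I" for B
    using that by blast
  have IT: "I \<subseteq> ?T" using I by (auto simp: ideal_in_def)
  \<comment> \<open>Elements of \<open>I\<close> are handled through representing polynomials,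
    because the argument compares degrees; \<open>t\<close> may satisfy relations, so
    \<open>ev\<close> need not be injective.\<close>
  define X where "X = {p. (\<forall>i. coeff p i \<in> S) \<and> poly p t \<in> I}"
  define ev where "ev = (\<lambda>p. poly p t)"
  define R where "R = (\<lambda>B p. ev p \<notin> ideal_gen ?T (ev ` B) \<and>
      (\<forall>q\<in>X. ev q \<notin> ideal_gen ?T (ev ` B) \<longrightarrow> degree p \<le> degree q))"
  have "\<exists>p\<in>X. R B p" if B: "finite B" "B \<subseteq> X" for B
  proof -
    have "finite (ev ` B)" "ev ` B \<subseteq> I" using B by (auto simp: X_def ev_def)
    from nfg[OF this] obtain x where x: "x \<in> I" "x \<notin> ideal_gen ?T (ev ` B)" by auto
    with IT obtain p where p: "x = poly p t" "\<forall>i. coeff p i \<in> S" by (auto simp: adjoin_def)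
    have "\<exists>p. (p \<in> X \<and> ev p \<notin> ideal_gen ?T (ev ` B)) \<and>
        (\<forall>q. q \<in> X \<and> ev q \<notin> ideal_gen ?T (ev ` B) \<longrightarrow> degree p \<le> degree q)"
      using p x by (intro ex_has_least_nat[of _ p]) (auto simp: X_def ev_def)
    then show ?thesis unfolding R_def by blast
  qed
  then obtain f :: "nat \<Rightarrow> 'x poly" where f: "\<And>n. f n \<in> X \<and> R (f ` {..<n}) (f n)"
    using sequence_by_finite_choice[of X R] by blast
  have fS: "coeff (f n) i \<in> S" for n i using f by (auto simp: X_def)
  have gen_sub: "ev ` f ` {..<n} \<subseteq> ?T" for n using f IT by (auto simp: X_def ev_def)
  obtain N k where k: "\<forall>i<N. k i \<in> S" "lead_coeff (f N) = (\<Sum>i<N. k i * lead_coeff (f i))"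
    using noetherian_sequence[OF noeth, of "\<lambda>n. lead_coeff (f n)"] fS by blast
  let ?J = "ideal_gen ?T (ev ` f ` {..<N})"
  have J: "ideal_in ?T ?J" by (rule T.ideal_gen_ideal[OF gen_sub])
  \<comment> \<open>\<open>f i\<close> was chosen of least degree against fewer predecessors, and
    \<open>f N\<close> was already a candidate then.\<close>
  have deg: "degree (f i) \<le> degree (f N)" if "i < N" for i
  proof -
    have "ideal_gen ?T (ev ` f ` {..<i}) \<subseteq> ?J" using that by (intro ideal_gen_mono) auto
    then show ?thesis using f[of i] f[of N] unfolding R_def by blast
  qed
  \<comment> \<open>Multiplication by \<open>m i\<close> lifts \<open>f i\<close> to the degree of
    \<open>f N\<close>, so that \<open>h\<close> has the top coefficient of \<open>f N\<close> while
    its value stays in \<open>?J\<close>.\<close>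
  define m where "m = (\<lambda>i. monom (k i) (degree (f N) - degree (f i)))"
  define h where "h = (\<Sum>i<N. m i * f i)"
  have mS: "coeff (m i) j \<in> S" if "i < N" for i j
    unfolding m_def using k that by (intro coeff_monom_mem) auto
  have mT: "ev (m i) \<in> ?T" if "i < N" for i
    unfolding adjoin_def ev_def using mS that by auto
  have hS: "coeff h i \<in> S" for i
    unfolding h_def by (intro coeff_sum_mem coeff_mult_mem) (auto simp: mS fS)
  have evh: "ev h = (\<Sum>i<N. ev (m i) * ev (f i))" by (simp add: h_def ev_def poly_sum)
  have h_J: "ev h \<in> ?J" unfolding evh
    using ideal_gen_superset[of "ev ` f ` {..<N}" ?T] mT
    by (intro ideal_in_sum[OF J] ideal_in_mult[OF J]) auto
  have h_I: "ev h \<in> I" unfolding evh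
    using mT f by (intro ideal_in_sum[OF I] ideal_in_mult[OF I]) (auto simp: X_def ev_def)
  have "f N - h \<in> X" unfolding X_def
    using fS hS h_I f[of N] ideal_in_add[OF I _ T.ideal_uminus[OF I h_I], of "poly (f N) t"]
    by (auto simp: X_def ev_def diff_mem)
  have degh: "degree h \<le> degree (f N)" unfolding h_def
  proof (intro degree_sum_le)
    fix i assume "i \<in> {..<N}"
    then have "degree (m i * f i) \<le> (degree (f N) - degree (f i)) + degree (f i)"
      by (intro order_trans[OF degree_mult_le] add_mono) (auto simp: m_def degree_monom_le)
    then show "degree (m i * f i) \<le> degree (f N)" using deg \<open>i \<in> {..<N}\<close> by auto
  qed auto
  have "coeff h (degree (f N)) = (\<Sum>i<N. k i * lead_coeff (f i))"
    unfolding h_def coeff_sum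
  proof (intro sum.cong refl)
    fix i assume "i \<in> {..<N}"
    then show "coeff (m i * f i) (degree (f N)) = k i * lead_coeff (f i)"
      using deg[of i] by (simp add: m_def coeff_monom_mult)
  qed
  then have top: "coeff (f N - h) (degree (f N)) = 0" using k(2) by simp
  \<comment> \<open>In degree zero the cancelled top coefficient makes \<open>f N - h\<close> zero;
    otherwise the degree drops and minimality of \<open>f N\<close> puts the value into
    \<open>?J\<close>.\<close>
  have "ev (f N - h) \<in> ?J"
  proof (cases "degree (f N) = 0")
    case True
    moreover have "degree (f N - h) \<le> 0" using True degh by (intro degree_diff_le) auto
    ultimately have "f N - h = 0" using top by (metis le_zero_eq leading_coeff_0_iff)
    then show ?thesis using J by (simp add: ev_def ideal_in_def)
  next
    case False
    have "degree (f N - h) \<le> degree (f N)" using degh by (intro degree_diff_le) auto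
    moreover have "degree (f N - h) \<noteq> degree (f N)"
      using top False by (metis degree_0 leading_coeff_0_iff)
    ultimately have "degree (f N - h) < degree (f N)" by simp
    then show ?thesis using f[of N] \<open>f N - h \<in> X\<close> unfolding R_def by (meson leD)
  qed
  from ideal_in_add[OF J this h_J] have "ev (f N) \<in> ?J" by (simp add: ev_def)
  then show False using f[of N] by (simp add: R_def)
qed

end

section \<open>Finitely generated algebras over the complex numbers\<close>

lemma C_embedding_uminus:
  assumes "is_C_embedding c" shows "c (- z) = - c z"
proof -
  have "c (- z) + c z = 0" using assms unfolding is_C_embedding_def by (metis add.left_inverse)
  then show ?thesis by (simp add: eq_neg_iff_add_eq_0)
qed

lemma C_subalgebra_subring:
  assumes "is_C_embedding c" "C_subalgebra c S"
  shows "unital_subring S"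
proof
  show "1 \<in> S" using assms unfolding is_C_embedding_def C_subalgebra_def by (metis rangeI subsetD)
  fix a assume "a \<in> S"
  moreover have "c (- 1) \<in> S" using assms by (auto simp: C_subalgebra_def)
  moreover have "c (- 1) = - 1"
    using C_embedding_uminus[OF assms(1)] assms(1) by (simp add: is_C_embedding_def)
  ultimately show "- a \<in> S" using assms by (metis C_subalgebra_def mult_minus1)
qed (use assms in \<open>auto simp: C_subalgebra_def\<close>)

lemma C_subalgebra_alg_gen: "C_subalgebra c (alg_gen c G)"
  by (auto simp: C_subalgebra_def intro: alg_gen.intros)

lemma alg_gen_least:
  assumes "C_subalgebra c T" "G \<subseteq> T" shows "alg_gen c G \<subseteq> T"
proof
  fix x assume "x \<in> alg_gen c G"
  then show "x \<in> T" using assms by induction (auto simp: C_subalgebra_def)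
qed

lemma alg_gen_mono: "G \<subseteq> H \<Longrightarrow> alg_gen c G \<subseteq> alg_gen c H"
  by (rule alg_gen_least[OF C_subalgebra_alg_gen]) (auto intro: alg_gen.gen)

lemma alg_gen_insert:
  assumes "is_C_embedding c"
  shows "alg_gen c (insert g G) = adjoin (alg_gen c G) g"
proof -
  interpret K: unital_subring "alg_gen c G"
    by (rule C_subalgebra_subring[OF assms C_subalgebra_alg_gen])
  interpret T: unital_subring "adjoin (alg_gen c G) g" by (rule K.adjoin_subring)
  show ?thesis
  proof (rule antisym)
    have "C_subalgebra c (adjoin (alg_gen c G) g)"
      unfolding C_subalgebra_def
    proof (intro conjI ballI)
      have "range c \<subseteq> alg_gen c G" by (auto intro: alg_gen.scalar)
      then show "range c \<subseteq> adjoin (alg_gen c G) g" using K.subset_adjoin by (rule order_trans)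
    qed (auto intro: T.add_mem T.mult_mem)
    then show "alg_gen c (insert g G) \<subseteq> adjoin (alg_gen c G) g"
      using K.subset_adjoin K.gen_mem_adjoin
      by (intro alg_gen_least) (use alg_gen.gen[of _ G c] in blast)+
    show "adjoin (alg_gen c G) g \<subseteq> alg_gen c (insert g G)"
      using C_subalgebra_subring[OF assms C_subalgebra_alg_gen, of "insert g G"]
      by (intro K.adjoin_least alg_gen_mono alg_gen.gen) auto
  qed
qed

lemma alg_gen_empty:
  assumes "is_C_embedding c" shows "alg_gen c {} = range c"
proof (rule antisym)
  show "alg_gen c {} \<subseteq> range c"
    using assms by (intro alg_gen_least)
      (auto simp: C_subalgebra_def is_C_embedding_def, (metis rangeI)+)
qed (auto intro: alg_gen.scalar)

lemma C_embedding_inverse: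
  assumes "is_C_embedding c" "z \<noteq> 0" shows "c (1 / z) * c z = 1"
  using assms unfolding is_C_embedding_def by (metis nonzero_eq_divide_eq)

text \<open>Adjoining one generator is Hilbert's theorem; the base \<open>range c\<close> is a
  field, so each of its nonzero elements generates the unit ideal.\<close>

lemma noetherian_alg_gen:
  assumes c: "is_C_embedding c" and "finite G"
  shows "noetherian_set (alg_gen c G)"
  using assms(2)
proof (induction G rule: finite_induct)
  case empty
  interpret unital_subring "alg_gen c {}"
    by (rule C_subalgebra_subring[OF c C_subalgebra_alg_gen])
  show ?case unfolding noetherian_set_def
  proof (intro allI impI)
    fix I assume I: "ideal_in (alg_gen c {}) I"
    show "\<exists>B. finite B \<and> B \<subseteq> I \<and> I \<subseteq> ideal_gen (alg_gen c {}) B"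
    proof (cases "I = {0}")
      case True
      then show ?thesis by (intro exI[of _ "{0}"]) (auto simp: ideal_gen_def)
    next
      case False
      then obtain x where x: "x \<in> I" "x \<noteq> 0" using I by (auto simp: ideal_in_def)
      with I obtain z where z: "x = c z"
        unfolding ideal_in_def alg_gen_empty[OF c] by blast
      with x c have "z \<noteq> 0" by (auto simp: is_C_embedding_def)
      then have inv: "c (1 / z) * x = 1" using C_embedding_inverse[OF c] z by simp
      have "y \<in> J" if "ideal_in (alg_gen c {}) J" "x \<in> J" "y \<in> alg_gen c {}" for J y
      proof -
        have "y * c (1 / z) \<in> alg_gen c {}" using that(3) by (intro alg_gen.mult alg_gen.scalar)
        from ideal_in_mult[OF that(1,2) this] show ?thesis using inv
          by (simp add: mult.assoc)
      qed
      moreover have "I \<subseteq> alg_gen c {}" using I by (simp add: ideal_in_def)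
      ultimately have "I \<subseteq> ideal_gen (alg_gen c {}) {x}" by (auto simp: ideal_gen_def)
      then show ?thesis using x by (intro exI[of _ "{x}"]) auto
    qed
  qed
next
  case (insert g G)
  interpret unital_subring "alg_gen c G"
    by (rule C_subalgebra_subring[OF c C_subalgebra_alg_gen])
  show ?case unfolding alg_gen_insert[OF c] by (rule noetherian_adjoin[OF insert.IH])
qed

subsection \<open>Height-one primes of normal Noetherian domains\<close>

context unital_subring begin

lemma prime_mult_notin: "prime_in S P \<Longrightarrow> a \<in> S - P \<Longrightarrow> b \<in> S - P \<Longrightarrow> a * b \<in> S - P"
  by (auto simp: prime_in_def mult_mem)

lemma prime_one_notin: "prime_in S P \<Longrightarrow> 1 \<in> S - P"
  by (auto simp: prime_in_def one_mem)

text \<open>The annihilator of the class of \<open>b\<close> in \<open>S\<^sub>P / a S\<^sub>P\<close>, contracted to \<open>S\<close>.\<close>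
definition loc_colon :: "'x set \<Rightarrow> 'x \<Rightarrow> 'x \<Rightarrow> 'x set" where
  "loc_colon P a b = {r \<in> S. \<exists>s\<in>S - P. \<exists>w\<in>S. s * (r * b) = a * w}"

lemma loc_colonI: "r \<in> S \<Longrightarrow> s \<in> S - P \<Longrightarrow> w \<in> S \<Longrightarrow> s * (r * b) = a * w \<Longrightarrow> r \<in> loc_colon P a b"
  unfolding loc_colon_def by blast

lemma loc_colonE:
  assumes "r \<in> loc_colon P a b"
  obtains s w where "r \<in> S" "s \<in> S - P" "w \<in> S" "s * (r * b) = a * w"
  using assms unfolding loc_colon_def by blast

lemma loc_colon_ideal:
  assumes P: "prime_in S P"
  shows "ideal_in S (loc_colon P a b)"
  unfolding ideal_in_def
proof (intro conjI ballI)
  show "loc_colon P a b \<subseteq> S" by (auto simp: loc_colon_def)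
  show "0 \<in> loc_colon P a b"
    using prime_one_notin[OF P] zero_mem by (force simp: loc_colon_def)
next
  fix r r' assume "r \<in> loc_colon P a b" "r' \<in> loc_colon P a b"
  then obtain s w s' w' where
    *: "r \<in> S" "r' \<in> S" "s \<in> S - P" "s' \<in> S - P" "w \<in> S" "w' \<in> S"
      "s * (r * b) = a * w" "s' * (r' * b) = a * w'"
    by (elim loc_colonE) blast
  have "(s * s') * ((r + r') * b) = s' * (s * (r * b)) + s * (s' * (r' * b))"
    by (simp add: algebra_simps)
  also have "\<dots> = a * (s' * w + s * w')" using * by (simp add: algebra_simps)
  finally show "r + r' \<in> loc_colon P a b"
    using * prime_mult_notin[OF P, of s s'] by (intro loc_colonI[of _ "s * s'" P "s' * w + s * w'"] add_mem mult_mem) auto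
next
  fix r q assume "r \<in> loc_colon P a b" "q \<in> S"
  then obtain s w where *: "r \<in> S" "s \<in> S - P" "w \<in> S" "s * (r * b) = a * w"
    by (elim loc_colonE)
  then have "s * (q * r * b) = a * (q * w)" by (metis mult.assoc mult.left_commute)
  then show "q * r \<in> loc_colon P a b"
    using * \<open>q \<in> S\<close> by (intro loc_colonI[of _ s P "q * w"] mult_mem)
qed

text \<open>A maximal member among the proper colon ideals is prime. It contains
  \<open>a \<noteq> 0\<close> and lies in \<open>P\<close>, so height one forces equality with
  \<open>P\<close>.\<close>

lemma loc_colon_height_one:
  assumes noeth: "noetherian_set S" and P: "height_one_in S P" and a: "a \<in> P" "a \<noteq> 0"
  obtains b where "b \<in> S" "loc_colon P a b = P"
proof -
  have prime: "prime_in S P" using P by (simp add: height_one_in_def)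
  then have idP: "ideal_in S P" by (simp add: prime_in_def)
  then have PS: "P \<subseteq> S" by (simp add: ideal_in_def)
  define F where "F = {loc_colon P a b | b. b \<in> S \<and> 1 \<notin> loc_colon P a b}"
  have "1 \<notin> loc_colon P a 1"
  proof
    assume "1 \<in> loc_colon P a 1"
    then obtain s w where "s \<in> S - P" "w \<in> S" "s = a * w" by (elim loc_colonE) simp
    with ideal_in_mult[OF idP a(1), of w] show False by (simp add: mult.commute)
  qed
  then have "F \<noteq> {}" unfolding F_def using one_mem by blast
  moreover have "ideal_in S I" if "I \<in> F" for I
    using that loc_colon_ideal[OF prime] by (auto simp: F_def)
  ultimately obtain M where M: "M \<in> F" "\<And>J. J \<in> F \<Longrightarrow> M \<subseteq> J \<Longrightarrow> J = M"
    using noetherian_maximal[OF noeth] by meson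
  from M(1) obtain b where b: "b \<in> S" "1 \<notin> loc_colon P a b" "M = loc_colon P a b"
    by (auto simp: F_def)
  have idM: "ideal_in S M" using b loc_colon_ideal[OF prime] by simp
  have "M \<subseteq> P"
  proof
    fix r assume "r \<in> M"
    then obtain s w where *: "r \<in> S" "s \<in> S - P" "w \<in> S" "s * (r * b) = a * w"
      unfolding b by (elim loc_colonE)
    show "r \<in> P"
    proof (rule ccontr)
      assume "r \<notin> P"
      then have "s * r \<in> S - P" using * prime_mult_notin[OF prime] by auto
      moreover have "(s * r) * (1 * b) = a * w" using * by (simp add: mult.assoc)
      ultimately have "1 \<in> loc_colon P a b" using * one_mem by (intro loc_colonI[of 1 "s * r" P w])
      with b show False by simp
    qed
  qed
  moreover have "prime_in S M" unfolding prime_in_def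
  proof (intro conjI ballI impI idM)
    show "1 \<notin> M" using b by simp
    fix r r' assume r: "r \<in> S" "r' \<in> S" "r * r' \<in> M"
    show "r \<in> M \<or> r' \<in> M"
    proof (rule disjCI)
      assume "r' \<notin> M"
      \<comment> \<open>Passing from \<open>b\<close> to \<open>r' * b\<close> enlarges the colon
        ideal and keeps it proper, so maximality of \<open>M\<close> leaves it unchanged;
        \<open>r\<close> belongs to the new one by construction.\<close>
      have "1 \<notin> loc_colon P a (r' * b)"
        using \<open>r' \<notin> M\<close> r unfolding b by (auto elim!: loc_colonE intro: loc_colonI)
      then have "loc_colon P a (r' * b) \<in> F" using r b by (auto simp: F_def mult_mem)
      moreover have "M \<subseteq> loc_colon P a (r' * b)"
      proof
        fix q assume "q \<in> M"
        then obtain s w where *: "q \<in> S" "s \<in> S - P" "w \<in> S" "s * (q * b) = a * w"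
          unfolding b by (elim loc_colonE)
        then have "s * (q * (r' * b)) = a * (r' * w)" by (metis mult.left_commute)
        then show "q \<in> loc_colon P a (r' * b)" using * r by (intro loc_colonI[of _ s P "r' * w"] mult_mem)
      qed
      ultimately have eq: "loc_colon P a (r' * b) = M" by (rule M(2))
      have "r \<in> loc_colon P a (r' * b)"
        using r unfolding b by (auto elim!: loc_colonE intro: loc_colonI simp: mult.assoc)
      with eq show "r \<in> M" by simp
    qed
  qed
  moreover have "a \<in> M"
    unfolding b using prime_one_notin[OF prime] a b PS by (intro loc_colonI[of a 1 P b]) auto
  moreover have "0 \<in> M" using idM by (simp add: ideal_in_def)
  ultimately have "M = P" using P a unfolding height_one_in_def by blast
  with b show thesis using that by blast
qed

text \<open>Multiplication by \<open>b / a\<close> preserves \<open>P\<close>. Noetherianity turns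
  its iterates on \<open>a\<close> into a monic equation, so \<open>b / a\<close> is integral over
  \<open>S\<close> and normality places it in \<open>S\<close>.\<close>

lemma normal_not_stable:
  assumes noeth: "noetherian_set S" and norm: "normal_domain S"
    and P: "ideal_in S P" and a: "a \<in> P" "a \<noteq> 0"
    and b: "b \<in> S" and stable: "\<And>p. p \<in> P \<Longrightarrow> \<exists>w\<in>P. b * p = a * w"
  shows "\<exists>w\<in>S. b = a * w"
proof -
  have PS: "P \<subseteq> S" using P by (simp add: ideal_in_def)
  from stable obtain h where h: "\<And>p. p \<in> P \<Longrightarrow> h p \<in> P \<and> b * p = a * h p" by metis
  \<comment> \<open>\<open>e n\<close> is the element \<open>(b / a) ^ n * a\<close>, kept inside
    \<open>P\<close>.\<close>
  define e where "e = (\<lambda>n. (h ^^ n) a)"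
  have eP: "e n \<in> P" for n by (induction n) (auto simp: e_def a h)
  have e: "a ^ n * e n = b ^ n * a" for n
  proof (induction n)
    case 0 then show ?case by (simp add: e_def)
  next
    case (Suc n)
    have "a ^ Suc n * e (Suc n) = a ^ n * (a * h (e n))" by (simp add: e_def mult_ac)
    also have "\<dots> = a ^ n * (b * e n)" using h[OF eP[of n]] by simp
    also have "\<dots> = b * (a ^ n * e n)" by (simp add: mult_ac)
    also have "\<dots> = b ^ Suc n * a" unfolding Suc by simp
    finally show ?case .
  qed
  obtain N k where k: "\<forall>i<N. k i \<in> S" "e N = (\<Sum>i<N. k i * e i)"
    using noetherian_sequence[OF noeth, of e] eP PS by blast
  have "b ^ N * a = a ^ N * (\<Sum>i<N. k i * e i)" using e[of N] k by simp
  \<comment> \<open>Once every term carries the factor \<open>a\<close>, cancelling it leaves the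
    homogeneous form of an integral equation for \<open>b / a\<close>.\<close>
  also have "\<dots> = (\<Sum>i<N. k i * b ^ i * a ^ (N - i)) * a"
    unfolding sum_distrib_left sum_distrib_right
  proof (intro sum.cong refl)
    fix i assume "i \<in> {..<N}"
    then have N: "a ^ N = a ^ (N - i) * a ^ i" by (simp flip: power_add)
    have "a ^ N * (k i * e i) = k i * a ^ (N - i) * (a ^ i * e i)" unfolding N by (simp add: mult_ac)
    then show "a ^ N * (k i * e i) = k i * b ^ i * a ^ (N - i) * a"
      unfolding e by (simp add: mult_ac)
  qed
  finally have "b ^ N + (\<Sum>i<N. (- k i) * b ^ i * a ^ (N - i)) = 0"
    using a by (simp add: sum_negf)
  moreover have "\<forall>i<N. - k i \<in> S" using k uminus_mem by auto
  ultimately have "\<exists>n cs. (\<forall>i<n. cs i \<in> S) \<and> b ^ n + (\<Sum>i<n. cs i * b ^ i * a ^ (n - i)) = 0"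
    by (intro exI[of _ N] exI[of _ "\<lambda>i. - k i"]) simp
  then show ?thesis using norm a b PS unfolding normal_domain_def by blast
qed

text \<open>Quantifying over all multiples \<open>u * s\<close> makes the property survive enlarging
  the denominator, so a product of the individual denominators works for all of
  \<open>B\<close>.\<close>

lemma common_denominator:
  assumes P: "prime_in S P" and "finite B"
    and "\<And>x. x \<in> B \<Longrightarrow> \<exists>s\<in>S - P. \<forall>u\<in>S. Q (u * s) x"
  shows "\<exists>s\<in>S - P. \<forall>x\<in>B. \<forall>u\<in>S. Q (u * s) x"
  using assms(2,3)
proof (induction B rule: finite_induct)
  case empty
  then show ?case using prime_one_notin[OF P] by auto
next
  case (insert x B)
  then obtain s s' where s: "s \<in> S - P" "\<forall>y\<in>B. \<forall>u\<in>S. Q (u * s) y"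
    "s' \<in> S - P" "\<forall>u\<in>S. Q (u * s') x" by (metis insert_iff)
  have "Q (u * (s * s')) y" if "y \<in> insert x B" "u \<in> S" for y u
    using that s mult_mem[of u s] mult_mem[of u s']
    by (metis DiffD1 insertE mult.assoc mult.commute)
  then show ?case using prime_mult_notin[OF P s(1,3)] by blast
qed

text \<open>Multiplication by \<open>b / a\<close> maps \<open>P\<close> into the local ring. If the
  image stayed in the maximal ideal, \<open>b / a\<close> would be integral, against
  \<open>loc_colon P a b = P\<close>. So some \<open>p\<close> is sent to a unit, and this
  \<open>p\<close> generates the maximal ideal.\<close>

lemma height_one_principal:
  assumes noeth: "noetherian_set S" and norm: "normal_domain S" and P: "height_one_in S P"
  shows "\<exists>y\<in>P. y \<noteq> 0 \<and> (\<forall>q\<in>P. \<exists>s\<in>S - P. \<exists>w\<in>S. s * q = y * w)"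
proof -
  have prime: "prime_in S P" using P by (simp add: height_one_in_def)
  then have idP: "ideal_in S P" by (simp add: prime_in_def)
  then have PS: "P \<subseteq> S" and "0 \<in> P" by (simp_all add: ideal_in_def)
  then obtain a where a: "a \<in> P" "a \<noteq> 0" using P by (auto simp: height_one_in_def)
  obtain b where b: "b \<in> S" "loc_colon P a b = P"
    using loc_colon_height_one[OF noeth P a] by blast
  have ex: "\<exists>s\<in>S - P. \<exists>w\<in>S. s * (p * b) = a * w" if "p \<in> P" for p
    using that b(2) by (metis loc_colonE)
  have "\<exists>p\<in>P. \<exists>s\<in>S - P. \<exists>w\<in>S - P. s * (p * b) = a * w"
  proof (rule ccontr)
    assume "\<not> ?thesis"
    with ex have ex: "\<exists>s\<in>S - P. \<exists>w\<in>P. s * (p * b) = a * w" if "p \<in> P" for p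
      using that by blast
    obtain B where B: "finite B" "B \<subseteq> P" "P \<subseteq> ideal_gen S B"
      using noeth idP unfolding noetherian_set_def by blast
    \<comment> \<open>One denominator \<open>s\<close> serves a finite generating set of
      \<open>P\<close>, hence all of \<open>P\<close>; so \<open>P\<close> itself, not just its
      localization, is stable under \<open>s * b / a\<close>.\<close>
    have "\<exists>s\<in>S - P. \<forall>p\<in>B. \<forall>u\<in>S. \<exists>w\<in>P. (u * s) * (p * b) = a * w"
    proof (rule common_denominator[OF prime B(1)])
      fix p assume "p \<in> B"
      then obtain s w where sw: "s \<in> S - P" "w \<in> P" "s * (p * b) = a * w" using B ex by blast
      have "\<exists>w\<in>P. (u * s) * (p * b) = a * w" if "u \<in> S" for u
        using ideal_in_mult[OF idP sw(2) that] sw(3) by (metis mult.assoc mult.left_commute)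
      then show "\<exists>s\<in>S - P. \<forall>u\<in>S. \<exists>w\<in>P. (u * s) * (p * b) = a * w" using sw by blast
    qed
    then obtain s where s: "s \<in> S - P" "\<forall>p\<in>B. \<exists>w\<in>P. s * (p * b) = a * w"
      using one_mem by (metis mult_1)
    let ?J = "{p \<in> P. \<exists>w\<in>P. s * (p * b) = a * w}"
    have "ideal_in S ?J" unfolding ideal_in_def
    proof (intro conjI ballI)
      show "?J \<subseteq> S" using PS by auto
      show "0 \<in> ?J" using \<open>0 \<in> P\<close> by force
    next
      fix p q assume "p \<in> ?J" "q \<in> ?J"
      then obtain v w where "p \<in> P" "q \<in> P" "v \<in> P" "w \<in> P" "s * (p * b) = a * v"
        "s * (q * b) = a * w" by auto
      moreover from this have "s * ((p + q) * b) = a * (v + w)" by (simp add: algebra_simps)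
      ultimately show "p + q \<in> ?J" using ideal_in_add[OF idP] by blast
    next
      fix p u assume "p \<in> ?J" "u \<in> S"
      then obtain v where "p \<in> P" "v \<in> P" "s * (p * b) = a * v" by auto
      moreover from this have "s * ((u * p) * b) = a * (u * v)"
        by (metis mult.assoc mult.left_commute)
      ultimately show "u * p \<in> ?J" using ideal_in_mult[OF idP _ \<open>u \<in> S\<close>] by blast
    qed
    then have "ideal_gen S B \<subseteq> ?J" using B s by (intro ideal_gen_least) auto
    then have "\<exists>w\<in>P. (s * b) * p = a * w" if "p \<in> P" for p
    proof -
      have "p \<in> ?J" using \<open>ideal_gen S B \<subseteq> ?J\<close> B(3) that by blast
      then obtain w where "w \<in> P" "s * (p * b) = a * w" by blast
      moreover have "(s * b) * p = s * (p * b)" by (simp add: mult_ac)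
      ultimately show ?thesis by (metis (full_types))
    qed
    from normal_not_stable[OF noeth norm idP a _ this]
    obtain w where "w \<in> S" "s * b = a * w" using s b mult_mem by auto
    then have "1 \<in> loc_colon P a b" using s one_mem by (intro loc_colonI[of 1 s P w]) auto
    with b prime show False by (simp add: prime_in_def)
  qed
  then obtain p s w where p: "p \<in> P" "s \<in> S - P" "w \<in> S - P" "s * (p * b) = a * w" by auto
  have "p \<noteq> 0" using p a \<open>0 \<in> P\<close> by auto
  moreover have "\<exists>u\<in>S - P. \<exists>v\<in>S. u * q = p * v" if q: "q \<in> P" for q
  proof -
    obtain s' w' where *: "s' \<in> S - P" "w' \<in> S" "s' * (q * b) = a * w'" using ex q by blast
    \<comment> \<open>\<open>p * b / a\<close> is the local unit \<open>w / s\<close>; comparison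
      with \<open>q * b / a\<close> eliminates \<open>b\<close> and makes \<open>q\<close> a local
      multiple of \<open>p\<close>.\<close>
    have "a * ((w * s') * q) = (s * (p * b)) * (s' * q)" unfolding p(4) by (simp add: mult_ac)
    also have "\<dots> = s * p * (s' * (q * b))" by (simp add: mult_ac)
    also have "\<dots> = a * (p * (s * w'))" unfolding *(3) by (simp add: mult_ac)
    finally have "(w * s') * q = p * (s * w')" using a by simp
    then show ?thesis
      using p * prime_mult_notin[OF prime, of w s'] mult_mem[of s w'] by blast
  qed
  ultimately show ?thesis using p by blast
qed

text \<open>Factors of \<open>y\<close> are pulled out of \<open>f\<close> until the cofactor leaves
  \<open>P\<close>. Noetherianity excludes divisibility by all powers of \<open>y\<close>.\<close>

lemma height_one_uniformizer:
  assumes noeth: "noetherian_set S" and norm: "normal_domain S" and P: "height_one_in S P"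
  shows "\<exists>y\<in>P. y \<noteq> 0 \<and> (\<forall>f\<in>S. f \<noteq> 0 \<longrightarrow> (\<exists>n. \<exists>s\<in>S - P. \<exists>t\<in>S - P. s * f = y ^ n * t))"
proof -
  have prime: "prime_in S P" using P by (simp add: height_one_in_def)
  then have idP: "ideal_in S P" by (simp add: prime_in_def)
  then have PS: "P \<subseteq> S" by (simp_all add: ideal_in_def)
  obtain y where y: "y \<in> P" "y \<noteq> 0" "\<And>q. q \<in> P \<Longrightarrow> \<exists>s\<in>S - P. \<exists>w\<in>S. s * q = y * w"
    using height_one_principal[OF assms] by blast
  have "\<exists>n. \<exists>s\<in>S - P. \<exists>t\<in>S - P. s * f = y ^ n * t" if f: "f \<in> S" "f \<noteq> 0" for f
  proof -
    let ?A = "\<lambda>n. \<exists>s\<in>S - P. \<exists>t\<in>S. s * f = y ^ n * t"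
    have "\<exists>n. \<not> ?A n"
    proof (rule ccontr)
      assume "\<not> ?thesis"
      then have all: "?A n" for n by blast
      \<comment> \<open>\<open>J n\<close> contracts the colon ideal of \<open>f\<close> by
        \<open>y ^ n\<close> in the local ring. The chain stabilises, so the quotient
        \<open>t\<close> of \<open>f\<close> by \<open>y ^ Suc n\<close> lies in \<open>J n\<close>,
        which would make \<open>y\<close> a local unit.\<close>
      define J where "J = (\<lambda>n. {g \<in> S. \<exists>s\<in>S - P. \<exists>h\<in>S. y ^ n * (s * g) = f * h})"
      have "ideal_in S (J n)" for n unfolding ideal_in_def
      proof (intro conjI ballI)
        show "J n \<subseteq> S" by (auto simp: J_def)
        show "0 \<in> J n" using prime_one_notin[OF prime] zero_mem by (force simp: J_def)
      next
        fix g g' assume "g \<in> J n" "g' \<in> J n"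
        then obtain s h s' h' where *: "g \<in> S" "g' \<in> S" "s \<in> S - P" "s' \<in> S - P" "h \<in> S"
          "h' \<in> S" "y ^ n * (s * g) = f * h" "y ^ n * (s' * g') = f * h'"
          by (auto simp: J_def)
        have "y ^ n * ((s * s') * (g + g')) = s' * (y ^ n * (s * g)) + s * (y ^ n * (s' * g'))"
          by (simp add: algebra_simps)
        also have "\<dots> = f * (s' * h + s * h')" using * by (simp add: algebra_simps)
        finally show "g + g' \<in> J n" unfolding J_def
          using * prime_mult_notin[OF prime *(3,4)] by (blast intro: add_mem mult_mem)
      next
        fix g u assume "g \<in> J n" "u \<in> S"
        then obtain s h where *: "g \<in> S" "s \<in> S - P" "h \<in> S" "y ^ n * (s * g) = f * h"
          by (auto simp: J_def)
        have "y ^ n * (s * (u * g)) = u * (y ^ n * (s * g))" by (simp add: mult_ac)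
        also have "\<dots> = f * (u * h)" using * by (simp add: mult_ac)
        finally show "u * g \<in> J n" using * \<open>u \<in> S\<close> unfolding J_def by (blast intro: mult_mem)
      qed
      then obtain n where n: "\<And>m. J n \<subseteq> J m \<Longrightarrow> J m = J n"
        using noetherian_maximal[OF noeth, of "range J"] by auto
      have "J n \<subseteq> J (Suc n)"
      proof
        fix g assume "g \<in> J n"
        then obtain s h where *: "g \<in> S" "s \<in> S - P" "h \<in> S" "y ^ n * (s * g) = f * h"
          by (auto simp: J_def)
        then have "y ^ Suc n * (s * g) = f * (y * h)"
          by (metis mult.assoc mult.left_commute power_Suc)
        then show "g \<in> J (Suc n)" using * y PS unfolding J_def by (blast intro: mult_mem)
      qed
      then have eq: "J (Suc n) = J n" by (rule n)
      obtain s t where st: "s \<in> S - P" "t \<in> S" "s * f = y ^ Suc n * t" using all by blast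
      have "y ^ Suc n * (1 * t) = f * s" using st by (simp add: mult_ac)
      then have "t \<in> J (Suc n)" using st prime_one_notin[OF prime] unfolding J_def by blast
      with eq obtain s' h where *: "s' \<in> S - P" "h \<in> S" "y ^ n * (s' * t) = f * h"
        by (auto simp: J_def)
      have "f * (s' * s) = y * (y ^ n * (s' * t))" using st by (simp add: mult_ac)
      also have "\<dots> = f * (h * y)" using * by (simp add: mult_ac)
      finally have "s' * s = h * y" using f by simp
      moreover have "h * y \<in> P" using idP y(1) *(2) by (rule ideal_in_mult)
      ultimately show False using prime_mult_notin[OF prime *(1) st(1)] by simp
    qed
    then have least: "\<not> ?A (LEAST n. \<not> ?A n)" by (rule LeastI_ex)
    have "1 * f = y ^ 0 * f" by simp
    then have A0: "?A 0" using prime_one_notin[OF prime] f by blast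
    with least obtain n where n: "(LEAST n. \<not> ?A n) = Suc n"
      by (metis (no_types, lifting) not0_implies_Suc)
    then have "?A n" using not_less_Least[of n "\<lambda>n. \<not> ?A n"] by auto
    then obtain s t where st: "s \<in> S - P" "t \<in> S" "s * f = y ^ n * t" by blast
    have "t \<notin> P"
    proof
      assume "t \<in> P"
      then obtain s' w where *: "s' \<in> S - P" "w \<in> S" "s' * t = y * w" using y by blast
      have "(s' * s) * f = y ^ n * (s' * t)" using st by (simp add: mult_ac)
      also have "\<dots> = y ^ Suc n * w" using * by (simp add: mult_ac)
      finally have "?A (Suc n)" using prime_mult_notin[OF prime *(1) st(1)] * by blast
      then show False using least n by simp
    qed
    then show ?thesis using st by blast
  qed
  then show ?thesis using y by blast
qed

end

lemma of_C_nat: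
  assumes "is_C_embedding c" shows "c (of_nat n) = of_nat n"
  using assms by (induction n) (auto simp: is_C_embedding_def)

text \<open>Inverses of positive integers come from the complex scalars. This supplies
  characteristic zero and keeps positive integers out of every prime.\<close>

lemma of_nat_unit:
  assumes "is_C_embedding c" "n > 0"
  shows "c (1 / of_nat n) * (of_nat n :: 'x::idom) = 1"
  using C_embedding_inverse[OF assms(1), of "of_nat n"] assms by (simp add: of_C_nat)

lemma degree_pderiv_le: "degree (pderiv p) \<le> degree (p :: 'x::idom poly) - 1"
  by (rule degree_le) (auto simp: coeff_pderiv coeff_eq_0)

subsection \<open>Extension of derivations\<close>

text \<open>Values lie in the whole ring rather than in \<open>K\<close>, and the behaviour outside
  \<open>K\<close> is unconstrained.\<close>

definition derivation_on :: "'x::comm_ring_1 set \<Rightarrow> ('x \<Rightarrow> 'x) \<Rightarrow> bool" where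
  "derivation_on K D \<longleftrightarrow>
     (\<forall>a\<in>K. \<forall>b\<in>K. D (a + b) = D a + D b \<and> D (a * b) = a * D b + b * D a)"

lemma derivation_on_add: "derivation_on K D \<Longrightarrow> a \<in> K \<Longrightarrow> b \<in> K \<Longrightarrow> D (a + b) = D a + D b"
  and derivation_on_mult: "derivation_on K D \<Longrightarrow> a \<in> K \<Longrightarrow> b \<in> K \<Longrightarrow> D (a * b) = a * D b + b * D a"
  by (auto simp: derivation_on_def)

lemma derivation_on_scale: "derivation_on K D \<Longrightarrow> derivation_on K (\<lambda>a. b * D a)"
  by (auto simp: derivation_on_def algebra_simps)

lemma derivation_power:
  assumes "derivation_on UNIV D"
  shows "D (x ^ Suc n) = of_nat (Suc n) * x ^ n * D x"
proof (induction n)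
  case 0 then show ?case by simp
next
  case (Suc n)
  have "D (x ^ Suc (Suc n)) = x * D (x ^ Suc n) + x ^ Suc n * D x"
    using derivation_on_mult[OF assms, of x "x ^ Suc n"] by simp
  also have "\<dots> = of_nat (Suc (Suc n)) * x ^ Suc n * D x"
    unfolding Suc by (simp add: algebra_simps)
  finally show ?case .
qed

context unital_subring begin

lemma derivation_on_zero: "derivation_on S D \<Longrightarrow> D 0 = 0"
  using derivation_on_add[of S D 0 0] zero_mem by (metis add_cancel_right_left add_0)

lemma derivation_on_one: "derivation_on S D \<Longrightarrow> D 1 = 0"
  using derivation_on_mult[of S D 1 1] one_mem by (metis add_cancel_right_left mult_1)

end

text \<open>The value at \<open>t\<close> of the derivative of \<open>p\<close> along the extension of \<open>D\<close> with \<open>D t = e\<close>.\<close>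
definition poly_derivation :: "('x::idom \<Rightarrow> 'x) \<Rightarrow> 'x \<Rightarrow> 'x \<Rightarrow> 'x poly \<Rightarrow> 'x" where
  "poly_derivation D t e p = poly (map_poly D p) t + poly (pderiv p) t * e"

context unital_subring begin

lemma poly_derivation_add:
  assumes D: "derivation_on S D" and "\<forall>i. coeff p i \<in> S" "\<forall>i. coeff q i \<in> S"
  shows "poly_derivation D t e (p + q) = poly_derivation D t e p + poly_derivation D t e q"
proof -
  have "map_poly D (p + q) = map_poly D p + map_poly D q"
    by (intro poly_eqI)
      (use assms in \<open>auto simp: coeff_map_poly derivation_on_zero derivation_on_add\<close>)
  then show ?thesis by (simp add: poly_derivation_def pderiv_add algebra_simps)
qed

lemma map_poly_derivation_pCons:
  assumes D: "derivation_on S D"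
  shows "map_poly D (pCons a p) = pCons (D a) (map_poly D p)"
  by (intro poly_eqI)
    (simp add: coeff_map_poly derivation_on_zero[OF D] coeff_pCons split: nat.split)

lemma poly_derivation_mult:
  assumes D: "derivation_on S D" and "\<forall>i. coeff p i \<in> S" and q: "\<forall>i. coeff q i \<in> S"
  shows "poly_derivation D t e (p * q) =
    poly p t * poly_derivation D t e q + poly q t * poly_derivation D t e p"
  using assms(2)
proof (induction p)
  case 0
  then show ?case by (simp add: poly_derivation_def)
next
  case (pCons a p)
  have a: "a \<in> S" using pCons.prems by (metis coeff_pCons_0)
  have p: "\<forall>i. coeff p i \<in> S" using pCons.prems by (metis coeff_pCons_Suc)
  have "map_poly D (smult a q) = smult a (map_poly D q) + smult (D a) q"
    by (intro poly_eqI)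
      (use D q a in \<open>auto simp: coeff_map_poly derivation_on_zero derivation_on_mult\<close>)
  then have 1: "poly_derivation D t e (smult a q) = a * poly_derivation D t e q + poly q t * D a"
    by (simp add: poly_derivation_def pderiv_smult algebra_simps)
  have 2: "poly_derivation D t e (pCons 0 (p * q)) =
      t * poly_derivation D t e (p * q) + poly (p * q) t * e"
    by (simp add: poly_derivation_def map_poly_derivation_pCons[OF D] derivation_on_zero[OF D]
        pderiv_pCons algebra_simps)
  have 3: "poly_derivation D t e (pCons a p) = D a + t * poly_derivation D t e p + poly p t * e"
    by (simp add: poly_derivation_def map_poly_derivation_pCons[OF D] pderiv_pCons algebra_simps)
  have "poly_derivation D t e (pCons a p * q) =
      poly_derivation D t e (smult a q) + poly_derivation D t e (pCons 0 (p * q))"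
    unfolding mult_pCons_left using a p q
    by (intro poly_derivation_add[OF D])
      (auto simp: mult_mem coeff_mult_mem zero_mem coeff_pCons split: nat.split)
  then show ?case unfolding 1 2 3 using pCons.IH[OF p] by (simp add: algebra_simps)
qed

text \<open>\<open>compat\<close> says that the formula vanishes on the relations of
  \<open>t\<close>. Applied to the difference of two polynomials with the same value, it makes the
  extension well defined.\<close>

lemma derivation_extend:
  assumes D: "derivation_on S D"
    and compat: "\<And>p. \<forall>i. coeff p i \<in> S \<Longrightarrow> poly p t = 0 \<Longrightarrow> poly_derivation D t e p = 0"
  shows "\<exists>D'. derivation_on (adjoin S t) D' \<and> (\<forall>a\<in>S. D' a = D a) \<and> D' t = e"
proof -
  define D' where "D' = (\<lambda>f. poly_derivation D t e (SOME p. (\<forall>i. coeff p i \<in> S) \<and> poly p t = f))"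
  have D': "D' (poly p t) = poly_derivation D t e p" if p: "\<forall>i. coeff p i \<in> S" for p
  proof -
    define q where "q = (SOME q. (\<forall>i. coeff q i \<in> S) \<and> poly q t = poly p t)"
    have q: "(\<forall>i. coeff q i \<in> S) \<and> poly q t = poly p t"
      unfolding q_def by (rule someI[of _ p]) (use p in auto)
    have "poly_derivation D t e (q + (p - q)) =
        poly_derivation D t e q + poly_derivation D t e (p - q)"
      using p q by (intro poly_derivation_add[OF D]) (auto simp: diff_mem)
    moreover have "poly_derivation D t e (p - q) = 0"
      using p q by (intro compat) (auto simp: diff_mem)
    ultimately show ?thesis by (simp add: D'_def q_def)
  qed
  have "derivation_on (adjoin S t) D'"
    unfolding derivation_on_def
  proof (intro ballI)
    fix a b assume "a \<in> adjoin S t" "b \<in> adjoin S t"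
    then obtain p q where p: "\<forall>i. coeff p i \<in> S" "a = poly p t"
      and q: "\<forall>i. coeff q i \<in> S" "b = poly q t"
      by (auto simp: adjoin_def)
    have "D' (poly (p + q) t) = poly_derivation D t e (p + q)"
      "D' (poly (p * q) t) = poly_derivation D t e (p * q)"
      using p q by (intro D'; auto simp: add_mem coeff_mult_mem)+
    then show "D' (a + b) = D' a + D' b \<and> D' (a * b) = a * D' b + b * D' a"
      using p q by (simp add: D' poly_derivation_add[OF D] poly_derivation_mult[OF D])
  qed
  moreover have "D' a = D a" if "a \<in> S" for a
    using D'[of "[:a:]"] that
    by (simp add: coeff_pCons zero_mem poly_derivation_def map_poly_derivation_pCons[OF D]
        pderiv_pCons split: nat.split)
  moreover have "D' t = e"
    using D'[of "[:0, 1:]"] D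
    by (simp add: coeff_pCons zero_mem one_mem poly_derivation_def
        map_poly_derivation_pCons[OF D] derivation_on_zero derivation_on_one
        pderiv_pCons split: nat.split)
  ultimately show ?thesis by blast
qed

text \<open>For a minimal relation \<open>q\<close>, the extension over the fraction field sends
  \<open>t\<close> to \<open>- poly (map_poly D q) t / poly (pderiv q) t\<close>. Scaling by the
  denominator \<open>b\<close> keeps all values in the ring.\<close>

lemma derivation_extend_algebraic:
  assumes D: "derivation_on S D" and char0: "\<And>n. n > 0 \<Longrightarrow> (of_nat n :: 'x) \<noteq> 0"
    and alg: "\<forall>i. coeff p i \<in> S" "p \<noteq> 0" "poly p t = 0"
  shows "\<exists>D' b. b \<noteq> 0 \<and> derivation_on (adjoin S t) D' \<and> (\<forall>a\<in>S. D' a = b * D a)"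
proof -
  let ?R = "\<lambda>q. (\<forall>i. coeff q i \<in> S) \<and> q \<noteq> 0 \<and> poly q t = 0"
  obtain q where q: "?R q" "\<And>r. ?R r \<Longrightarrow> degree q \<le> degree r"
    using ex_has_least_nat[of ?R p degree] alg by blast
  have deg: "degree q > 0"
  proof (rule ccontr)
    assume "\<not> degree q > 0"
    then obtain a where "q = [:a:]" using degree_eq_zeroE by blast
    with q show False by simp
  qed
  \<comment> \<open>The derivative has smaller degree and, in characteristic zero, is not zero;
    minimality of \<open>q\<close> prevents it from vanishing at \<open>t\<close>.\<close>
  have "coeff (pderiv q) (degree q - 1) = of_nat (degree q) * lead_coeff q"
    using deg by (simp add: coeff_pderiv)
  then have "pderiv q \<noteq> 0" using char0[OF deg] q deg by auto
  moreover have "\<forall>i. coeff (pderiv q) i \<in> S"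
    using q of_nat_mem[of "Suc _"] by (auto simp only: coeff_pderiv intro!: mult_mem)
  moreover have "degree (pderiv q) < degree q"
    using degree_pderiv_le[of q] deg by linarith
  ultimately have b: "poly (pderiv q) t \<noteq> 0" using q(2)[of "pderiv q"] by fastforce
  define b where "b = poly (pderiv q) t"
  define e where "e = - poly (map_poly D q) t"
  define D1 where "D1 = (\<lambda>a. b * D a)"
  have D1: "derivation_on S D1" unfolding D1_def by (rule derivation_on_scale[OF D])
  have "map_poly D1 q = smult b (map_poly D q)"
    by (intro poly_eqI) (simp add: coeff_map_poly D1_def derivation_on_zero[OF D])
  then have PD_q: "poly_derivation D1 t e q = 0"
    by (simp add: poly_derivation_def e_def b_def)
  have "poly_derivation D1 t e r = 0" if "\<forall>i. coeff r i \<in> S" "poly r t = 0" for r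
    using that
  proof (induction "degree r" arbitrary: r rule: less_induct)
    case less
    show ?case
    proof (cases "r = 0")
      case True
      then show ?thesis by (simp add: poly_derivation_def)
    next
      case False
      with less.prems q have le: "degree q \<le> degree r" by blast
      \<comment> \<open>Pseudo-division: leading coefficients need not be units, so \<open>r\<close>
        is multiplied by that of \<open>q\<close> before a multiple of \<open>q\<close> is
        subtracted; the factor is cancelled at the end.\<close>
      define a where "a = [:lead_coeff q:]"
      define m where "m = monom (lead_coeff r) (degree r - degree q)"
      have aS: "\<forall>i. coeff a i \<in> S"
        using q unfolding a_def by (auto simp: coeff_pCons zero_mem split: nat.split)
      have mS: "\<forall>i. coeff m i \<in> S"
        using less.prems unfolding m_def by (auto intro: coeff_monom_mem simp del: coeff_monom)
      have ar: "\<forall>i. coeff (a * r) i \<in> S" using aS less.prems by (auto intro: coeff_mult_mem)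
      have mq: "\<forall>i. coeff (m * q) i \<in> S" using mS q by (auto intro: coeff_mult_mem)
      define u where "u = a * r - m * q"
      have uS: "\<forall>i. coeff u i \<in> S" using ar mq by (auto simp: u_def diff_mem)
      have ut: "poly u t = 0" using q less.prems by (simp add: u_def)
      have "degree (m * q) \<le> (degree r - degree q) + degree q"
        unfolding m_def by (intro order_trans[OF degree_mult_le] add_mono degree_monom_le) auto
      then have "degree u \<le> degree r"
        unfolding u_def using le by (intro degree_diff_le) (auto simp: a_def)
      moreover have "coeff u (degree r) = 0"
        using le by (simp add: u_def a_def m_def coeff_monom_mult)
      moreover have "degree r > 0" using deg le by linarith
      ultimately have "degree u < degree r"
        by (metis degree_0 le_neq_implies_less leading_coeff_0_iff)
      then have u: "poly_derivation D1 t e u = 0" using less.hyps uS ut by blast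
      have "poly_derivation D1 t e (u + m * q) = poly_derivation D1 t e u +
          poly_derivation D1 t e (m * q)"
        using uS mq by (rule poly_derivation_add[OF D1])
      also have "poly_derivation D1 t e (m * q) = 0"
        using poly_derivation_mult[OF D1 mS, of q t e] q PD_q by simp
      finally have "poly_derivation D1 t e (a * r) = 0" using u by (simp add: u_def)
      moreover have "poly_derivation D1 t e (a * r) = lead_coeff q * poly_derivation D1 t e r"
        using poly_derivation_mult[OF D1 aS less.prems(1), of t e] less.prems(2)
        by (simp add: a_def)
      ultimately show ?thesis using q by simp
    qed
  qed
  from derivation_extend[OF D1 this] show ?thesis using b unfolding D1_def b_def by blast
qed

lemma derivation_extend_simple:
  assumes D: "derivation_on S D" and char0: "\<And>n. n > 0 \<Longrightarrow> (of_nat n :: 'x) \<noteq> 0"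
  shows "\<exists>D' b. b \<noteq> 0 \<and> derivation_on (adjoin S t) D' \<and> (\<forall>a\<in>S. D' a = b * D a)"
proof (cases "\<exists>p. (\<forall>i. coeff p i \<in> S) \<and> p \<noteq> 0 \<and> poly p t = 0")
  case True
  then show ?thesis using derivation_extend_algebraic[OF D char0] by blast
next
  case False
  then have "poly_derivation D t 0 p = 0" if "\<forall>i. coeff p i \<in> S" "poly p t = 0" for p
    using that by (cases "p = 0") (auto simp: poly_derivation_def)
  from derivation_extend[OF D this] show ?thesis by (metis mult_1 one_neq_zero)
qed

end

text \<open>Generators are adjoined one at a time, each at the cost of a nonzero scale factor;
  \<open>b\<close> is their product.\<close>

lemma derivation_extend_alg_gen:
  assumes c: "is_C_embedding c" and "finite H" and D: "derivation_on (alg_gen c V) D"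
  shows "\<exists>D' b. b \<noteq> 0 \<and> derivation_on (alg_gen c (H \<union> V)) D' \<and>
    (\<forall>a\<in>alg_gen c V. D' a = b * D a)"
  using assms(2)
proof (induction H rule: finite_induct)
  case empty
  then show ?case using D by (intro exI[of _ D] exI[of _ 1]) auto
next
  case (insert h H)
  then obtain D' b where D': "b \<noteq> 0" "derivation_on (alg_gen c (H \<union> V)) D'"
    "\<forall>a\<in>alg_gen c V. D' a = b * D a" by blast
  interpret unital_subring "alg_gen c (H \<union> V)"
    by (rule C_subalgebra_subring[OF c C_subalgebra_alg_gen])
  have "(of_nat n :: 'a) \<noteq> 0" if "n > 0" for n
    using of_nat_unit[OF c that] by auto
  from derivation_extend_simple[OF D'(2) this, of h]
  obtain D'' b' where D'': "b' \<noteq> 0" "derivation_on (alg_gen c (insert h (H \<union> V))) D''"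
    "\<forall>a\<in>alg_gen c (H \<union> V). D'' a = b' * D' a"
    unfolding alg_gen_insert[OF c] by blast
  have "\<forall>a\<in>alg_gen c V. D'' a = (b' * b) * D a"
    using D'(3) D''(3) alg_gen_mono[of V "H \<union> V" c] by (auto simp: mult.assoc)
  then show ?case using D' D'' by (intro exI[of _ D''] exI[of _ "b' * b"]) simp
qed

subsection \<open>Valuations at height-one primes\<close>

text \<open>\<open>decomp\<close> says that the localization at \<open>Q\<close> is a discrete
  valuation ring with parameter \<open>x\<close>; its units appear as pairs \<open>s\<close>,
  \<open>t\<close> outside \<open>Q\<close>.\<close>

locale uniformizer =
  fixes Q :: "'x::idom set" and x :: 'x
  assumes prime: "prime_in UNIV Q" and x_mem: "x \<in> Q" and x_nonzero: "x \<noteq> 0"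
    and decomp: "f \<noteq> 0 \<Longrightarrow> \<exists>n s t. s \<notin> Q \<and> t \<notin> Q \<and> s * f = x ^ n * t"
begin

lemma ideal: "ideal_in UNIV Q" using prime by (simp add: prime_in_def)

lemma one_notin: "1 \<notin> Q" using prime by (simp add: prime_in_def)

lemma mult_notin: "s \<notin> Q \<Longrightarrow> t \<notin> Q \<Longrightarrow> s * t \<notin> Q"
  using prime by (auto simp: prime_in_def)

lemma mult_mem_left: "f \<in> Q \<Longrightarrow> g * f \<in> Q" using ideal by (simp add: ideal_in_def)

lemma mult_mem_right: "f \<in> Q \<Longrightarrow> f * g \<in> Q" using mult_mem_left[of f g] by (simp add: mult.commute)

lemma add_mem: "f \<in> Q \<Longrightarrow> g \<in> Q \<Longrightarrow> f + g \<in> Q" using ideal by (simp add: ideal_in_def)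

lemma diff_mem: "f \<in> Q \<Longrightarrow> g \<in> Q \<Longrightarrow> f - g \<in> Q"
  using add_mem[of f "- g"] mult_mem_left[of g "- 1"] by simp

lemma zero_mem: "0 \<in> Q" using ideal by (simp add: ideal_in_def)

text \<open>The relation \<open>v\<^sub>Q(f) \<ge> n\<close>, where \<open>v\<^sub>Q(0) = \<infinity>\<close>.\<close>
definition vge :: "nat \<Rightarrow> 'x \<Rightarrow> bool" where
  "vge n f \<longleftrightarrow> (\<exists>s. s \<notin> Q \<and> x ^ n dvd s * f)"

lemma vge_dvd: "x ^ n dvd f \<Longrightarrow> vge n f"
  unfolding vge_def using one_notin by (intro exI[of _ 1]) simp

lemma vge_zero: "vge n 0" by (rule vge_dvd) simp

lemma vge_0: "vge 0 f" by (rule vge_dvd) simp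

lemma vge_mono: "vge n f \<Longrightarrow> m \<le> n \<Longrightarrow> vge m f"
  unfolding vge_def by (meson dvd_trans le_imp_power_dvd)

lemma vge_add:
  assumes "vge n f" "vge n g" shows "vge n (f + g)"
proof -
  obtain s t where "s \<notin> Q" "x ^ n dvd s * f" "t \<notin> Q" "x ^ n dvd t * g"
    using assms by (auto simp: vge_def)
  moreover from this have "x ^ n dvd t * (s * f) + s * (t * g)" by (simp add: dvd_add dvd_mult)
  ultimately show ?thesis unfolding vge_def using mult_notin[of s t]
    by (intro exI[of _ "s * t"]) (simp add: algebra_simps)
qed

lemma vge_mult:
  assumes "vge n f" "vge m g" shows "vge (n + m) (f * g)"
proof -
  obtain s t where "s \<notin> Q" "x ^ n dvd s * f" "t \<notin> Q" "x ^ m dvd t * g"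
    using assms by (auto simp: vge_def)
  moreover from this have "x ^ n * x ^ m dvd (s * f) * (t * g)" by (intro mult_dvd_mono)
  ultimately show ?thesis unfolding vge_def using mult_notin[of s t]
    by (intro exI[of _ "s * t"]) (simp add: power_add mult_ac)
qed

lemma vge_mult_left: "vge n f \<Longrightarrow> vge n (g * f)"
  using vge_mult[OF vge_0[of g], of n f] by simp

lemma vge_diff: "vge n f \<Longrightarrow> vge n g \<Longrightarrow> vge n (f - g)"
  using vge_add[of n f "- g"] vge_mult_left[of n g "- 1"] by simp

lemma vge_cancel_unit:
  assumes "vge n (s * f)" "s \<notin> Q" shows "vge n f"
proof -
  obtain t where "t \<notin> Q" "x ^ n dvd t * (s * f)" using assms by (auto simp: vge_def)
  then show ?thesis unfolding vge_def using mult_notin[OF _ assms(2)]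
    by (intro exI[of _ "t * s"]) (simp add: mult.assoc)
qed

lemma vge_cancel_power:
  assumes "vge (k + n) (x ^ k * f)" shows "vge n f"
proof -
  obtain s where "s \<notin> Q" "x ^ k * x ^ n dvd x ^ k * (s * f)"
    using assms by (auto simp: vge_def power_add mult_ac)
  then show ?thesis unfolding vge_def using x_nonzero by auto
qed

lemma vge_exact:
  assumes "s * f = x ^ n * t" "s \<notin> Q" "t \<notin> Q"
  shows "vge m f \<longleftrightarrow> m \<le> n"
proof
  assume "vge m f"
  show "m \<le> n"
  proof (rule ccontr)
    assume "\<not> m \<le> n"
    then have "vge (n + 1) f" using vge_mono[OF \<open>vge m f\<close>, of "n + 1"] by simp
    then have "vge (n + 1) (x ^ n * t)" using vge_mult_left[of _ f s] assms by metis
    then have "vge 1 t" by (rule vge_cancel_power)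
    then obtain u k where "u \<notin> Q" "u * t = x * k" by (auto simp: vge_def elim!: dvdE)
    then show False using mult_notin[OF _ assms(3)] mult_mem_right[OF x_mem] by metis
  qed
next
  assume "m \<le> n"
  have "vge n (s * f)" unfolding assms by (rule vge_dvd) simp
  then show "vge m f" using vge_cancel_unit assms(2) vge_mono \<open>m \<le> n\<close> by blast
qed

lemma vge_1_iff: "vge 1 f \<longleftrightarrow> f \<in> Q"
proof
  assume "vge 1 f"
  then obtain u k where "u \<notin> Q" "u * f = x * k" by (auto simp: vge_def elim!: dvdE)
  then show "f \<in> Q" using mult_notin mult_mem_right[OF x_mem] by metis
next
  assume "f \<in> Q"
  show "vge 1 f"
  proof (cases "f = 0")
    case False
    from decomp[OF this] obtain n s t where st: "s \<notin> Q" "t \<notin> Q" "s * f = x ^ n * t" by blast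
    have "n \<noteq> 0" using st mult_mem_left[OF \<open>f \<in> Q\<close>, of s] by (metis mult_1 power_0)
    then show ?thesis using vge_exact[OF st(3,1,2)] by simp
  qed (simp add: vge_zero)
qed

lemma vge_in_ideal_power: "in_ideal_power Q n f \<Longrightarrow> vge n f"
proof (induction rule: in_ideal_power.induct)
  case (prod q n y)
  then show ?case using vge_mult[of 1 q n y] by (simp add: vge_1_iff[symmetric])
qed (auto intro: vge_0 vge_add)

lemma in_ideal_power_uniformizer: "in_ideal_power Q n (x ^ n * k)"
  by (induction n) (auto simp: mult.assoc intro: in_ideal_power.intros x_mem)

text \<open>Locally the powers of \<open>Q\<close> are generated by those of \<open>x\<close>.
  Through this the ramification index is read off from \<open>vge\<close>.\<close>

lemma symbolic_power_eq: "symbolic_power Q n = {f. vge n f}"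
proof (intro set_eqI iffI)
  fix f assume "f \<in> symbolic_power Q n"
  then show "f \<in> {f. vge n f}"
    unfolding symbolic_power_def by (auto dest!: vge_in_ideal_power dest: vge_cancel_unit)
next
  fix f assume "f \<in> {f. vge n f}"
  then show "f \<in> symbolic_power Q n"
    using in_ideal_power_uniformizer[of n] unfolding symbolic_power_def vge_def dvd_def by force
qed

lemma common_multiple:
  assumes "finite G" "\<And>g. g \<in> G \<Longrightarrow> vge n (D g)"
  shows "\<exists>s. s \<notin> Q \<and> (\<forall>g\<in>G. x ^ n dvd s * D g)"
  using assms
proof (induction G rule: finite_induct)
  case empty
  then show ?case using one_notin by blast
next
  case (insert g G)
  then obtain s t where "s \<notin> Q" "\<forall>g\<in>G. x ^ n dvd s * D g" "t \<notin> Q" "x ^ n dvd t * D g"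
    unfolding vge_def by (metis insert_iff)
  moreover have "x ^ n dvd (s * t) * D h" if "x ^ n dvd s * D h \<or> x ^ n dvd t * D h" for h
    using that by (metis dvd_mult mult.assoc mult.commute)
  ultimately show ?case using mult_notin[of s t] by (intro exI[of _ "s * t"]) auto
qed

text \<open>A derivation with \<open>D x \<noteq> 0\<close> that vanishes on lifts \<open>U\<close> of a transcendence basis of the
  residue field is divided by the largest power of \<open>x\<close> possible. If the quotient still mapped
  \<open>Q\<close> to itself, it would induce the zero derivation of the residue field, which is algebraic
  over the part generated by \<open>U\<close>, contradicting maximality of the power.\<close>
lemma transverse_derivation:
  assumes c: "is_C_embedding c" and G: "finite G" "alg_gen c G = UNIV"
  shows "\<exists>\<delta>. derivation_on UNIV \<delta> \<and> (\<forall>z. \<delta> (c z) = 0) \<and> \<delta> x \<notin> Q"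
proof -
  \<comment> \<open>For \<open>U\<close> in \<open>F\<close> the algebra it generates embeds into
    the residue ring modulo \<open>Q\<close>. A maximal \<open>U\<close> makes every other generator
    algebraic modulo \<open>Q\<close> over that algebra.\<close>
  define F where "F = {U. U \<subseteq> G \<and> alg_gen c U \<inter> Q \<subseteq> {0}}"
  have "finite F" unfolding F_def using G(1) by (auto intro: finite_subset[of _ "Pow G"])
  moreover have "{} \<in> F"
  proof -
    have "y = 0" if y: "y \<in> alg_gen c {}" "y \<in> Q" for y
    proof -
      obtain z where z: "y = c z" using y alg_gen_empty[OF c] by auto
      show ?thesis
      proof (cases "z = 0")
        case False
        then have "c (1 / z) * y = 1" using C_embedding_inverse[OF c] z by simp
        then show ?thesis using mult_mem_left[OF y(2), of "c (1 / z)"] one_notin by simp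
      qed (use c z in \<open>simp add: is_C_embedding_def\<close>)
    qed
    then show ?thesis by (auto simp: F_def)
  qed
  ultimately obtain U where U: "U \<in> F" "\<And>V. V \<in> F \<Longrightarrow> U \<subseteq> V \<Longrightarrow> V = U"
    using finite_has_maximal[of F] by blast
  define K where "K = alg_gen c U"
  interpret K: unital_subring K
    unfolding K_def by (rule C_subalgebra_subring[OF c C_subalgebra_alg_gen])
  have KQ: "a = 0" if "a \<in> K" "a \<in> Q" for a using U(1) that by (auto simp: F_def K_def)
  have D0: "derivation_on K (\<lambda>_. 0)" by (simp add: derivation_on_def)
  \<comment> \<open>\<open>x\<close> is transcendental over \<open>K\<close>: the constant
    coefficient of a relation lies in \<open>K\<close> and in \<open>Q\<close>, so it is zero and
    \<open>x\<close> can be cancelled.\<close>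
  have trans: "p = 0" if "\<forall>i. coeff p i \<in> K" "poly p x = 0" for p
    using that
  proof (induction p)
    case (pCons a p)
    have "a = 0 - x * poly p x" using pCons.prems(2) by (simp add: eq_neg_iff_add_eq_0)
    moreover have "\<dots> \<in> Q" by (intro diff_mem zero_mem mult_mem_right x_mem)
    moreover have "a \<in> K" using pCons.prems by (metis coeff_pCons_0)
    ultimately have "a = 0" using KQ by metis
    moreover have "p = 0"
      using pCons.prems \<open>a = 0\<close> x_nonzero by (intro pCons.IH) (auto, metis coeff_pCons_Suc)
    ultimately show ?case by simp
  qed simp
  have "\<exists>D. derivation_on (adjoin K x) D \<and> (\<forall>a\<in>K. D a = 0) \<and> D x = 1"
  proof (rule K.derivation_extend[OF D0])
    fix p assume "\<forall>i. coeff p i \<in> K" "poly p x = 0"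
    from trans[OF this] show "poly_derivation (\<lambda>_. 0) x 1 p = 0" by (simp add: poly_derivation_def)
  qed
  then obtain D1 where D1: "derivation_on (alg_gen c (insert x U)) D1" "\<forall>a\<in>K. D1 a = 0" "D1 x = 1"
    unfolding alg_gen_insert[OF c] K_def by blast
  obtain D b where b: "b \<noteq> 0" and "derivation_on (alg_gen c (G \<union> insert x U)) D"
    and Db: "\<forall>a\<in>alg_gen c (insert x U). D a = b * D1 a"
    using derivation_extend_alg_gen[OF c G(1) D1(1)] by blast
  moreover have "alg_gen c (G \<union> insert x U) = UNIV"
    using alg_gen_mono[of G "G \<union> insert x U" c] G by auto
  ultimately have D: "derivation_on UNIV D" by simp
  have DK: "D a = 0" if "a \<in> K" for a
    using that Db D1(2) alg_gen_mono[OF subset_insertI[of U x], of c] by (auto simp: K_def)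
  have Dx: "D x \<noteq> 0" using Db D1 b by (simp add: alg_gen.gen)
  have Dc: "D (c z) = 0" for z by (intro DK) (simp add: K_def alg_gen.scalar)
  \<comment> \<open>By the Leibniz rule, a property of values that is stable under linear
    combinations passes from the generators to the whole ring.\<close>
  have gens: "I (E f)" if "I 0" "\<And>a b f g. I a \<Longrightarrow> I b \<Longrightarrow> I (f * a + g * b)"
    "derivation_on UNIV E" "\<And>z. E (c z) = 0" "\<And>g. g \<in> G \<Longrightarrow> I (E g)" for I E f
  proof -
    have "f \<in> alg_gen c G" using G by simp
    then show ?thesis
    proof induction
      case (add a b)
      then show ?case using that(2)[of "E a" "E b" 1 1] derivation_on_add[OF that(3)] by simp
    next
      case (mult a b)
      then show ?case using that(2)[of "E b" "E a" a b] derivation_on_mult[OF that(3)] by simp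
    qed (use that in auto)
  qed
  \<comment> \<open>\<open>D\<close> is not zero, so some generator has a value of finite order
    along \<open>Q\<close>; \<open>N\<close> below is the least such order.\<close>
  have "\<exists>n. \<not> (\<forall>g\<in>G. vge (Suc n) (D g))"
  proof (rule ccontr)
    assume "\<not> ?thesis"
    then have all: "vge (Suc n) (D g)" if "g \<in> G" for n g using that by blast
    have "D g = 0" if "g \<in> G" for g
    proof (rule ccontr)
      assume "D g \<noteq> 0"
      from decomp[OF this] obtain n s t where "s \<notin> Q" "t \<notin> Q" "s * D g = x ^ n * t" by blast
      then show False using vge_exact[of s "D g" n t "Suc n"] all[OF that] by simp
    qed
    then have "D x = 0" using gens[of "\<lambda>a. a = 0" D x] D Dc by simp
    with Dx show False by simp
  qed
  define N where "N = (LEAST n. \<not> (\<forall>g\<in>G. vge (Suc n) (D g)))"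
  have "\<not> (\<forall>g\<in>G. vge (Suc N) (D g))"
    unfolding N_def using \<open>\<exists>n. \<not> (\<forall>g\<in>G. vge (Suc n) (D g))\<close> by (rule LeastI_ex)
  then obtain g where g: "g \<in> G" "\<not> vge (Suc N) (D g)" by blast
  have "vge N (D h)" if "h \<in> G" for h
  proof (cases N)
    case (Suc n)
    then have "\<forall>g\<in>G. vge (Suc n) (D g)"
      using not_less_Least[of n "\<lambda>n. \<not> (\<forall>g\<in>G. vge (Suc n) (D g))"] by (auto simp: N_def)
    with Suc that show ?thesis by simp
  qed (simp add: vge_0)
  then obtain s where s: "s \<notin> Q" "\<forall>h\<in>G. x ^ N dvd s * D h"
    using common_multiple[OF G(1), of N D] by blast
  have "x ^ N dvd s * D f" for f
    by (rule gens[of "\<lambda>a. x ^ N dvd s * a" D f])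
      (use D Dc s in \<open>auto simp: distrib_left mult.left_commute[of s] intro!: dvd_add dvd_mult\<close>)
  then have "\<exists>h. s * D f = x ^ N * h" for f by (auto elim!: dvdE)
  \<comment> \<open>\<open>\<delta>\<close> is \<open>s * D\<close> divided by \<open>x ^ N\<close>;
    the factor \<open>s\<close> makes the division exact in the ring.\<close>
  then obtain \<delta> where \<delta>: "\<And>f. s * D f = x ^ N * \<delta> f" by metis
  have xN: "x ^ N \<noteq> 0" using x_nonzero by simp
  have der: "derivation_on UNIV \<delta>"
    unfolding derivation_on_def
  proof (intro ballI conjI)
    fix f h
    have "x ^ N * \<delta> (f + h) = x ^ N * (\<delta> f + \<delta> h)"
      unfolding distrib_left \<delta>[symmetric] by (simp add: derivation_on_add[OF D] distrib_left)
    then show "\<delta> (f + h) = \<delta> f + \<delta> h" using xN mult_left_cancel by blast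
    have "x ^ N * \<delta> (f * h) = f * (x ^ N * \<delta> h) + h * (x ^ N * \<delta> f)"
      unfolding \<delta>[symmetric] by (simp add: derivation_on_mult[OF D] algebra_simps)
    also have "\<dots> = x ^ N * (f * \<delta> h + h * \<delta> f)" by (simp add: algebra_simps)
    finally show "\<delta> (f * h) = f * \<delta> h + h * \<delta> f" using xN mult_left_cancel by blast
  qed
  have \<delta>K: "\<delta> a = 0" if "a \<in> K" for a using \<delta>[of a] DK[OF that] xN
    by (metis mult_eq_0_iff mult_zero_right)
  have \<delta>g: "\<delta> g \<notin> Q"
  proof
    assume "\<delta> g \<in> Q"
    then have "vge 1 (\<delta> g)" using vge_1_iff by blast
    then have "vge (N + 1) (x ^ N * \<delta> g)" by (rule vge_mult[OF vge_dvd[OF dvd_refl]])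
    then have "vge (Suc N) (s * D g)" by (simp add: \<delta>)
    then show False using g s vge_cancel_unit by blast
  qed
  have "\<delta> x \<notin> Q"
  proof
    assume \<delta>x: "\<delta> x \<in> Q"
    \<comment> \<open>Locally an element of \<open>Q\<close> is a multiple of \<open>x\<close>, so
      \<open>\<delta>\<close> preserves \<open>Q\<close> as soon as it sends \<open>x\<close>
      there.\<close>
    have \<delta>Q: "\<delta> f \<in> Q" if "f \<in> Q" for f
    proof -
      have "vge 1 f" using that vge_1_iff by blast
      then obtain u k where u: "u \<notin> Q" "u * f = x * k" by (auto simp: vge_def elim!: dvdE)
      have "\<delta> (u * f) = \<delta> (x * k)" using u by simp
      then have "u * \<delta> f = (x * \<delta> k + k * \<delta> x) - f * \<delta> u"
        by (simp add: derivation_on_mult[OF der] algebra_simps)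
      also have "\<dots> \<in> Q"
        using that \<delta>x x_mem by (intro diff_mem add_mem mult_mem_left mult_mem_right)
      finally show ?thesis using u mult_notin by blast
    qed
    have "g \<notin> U" using \<delta>K[of g] \<delta>g zero_mem by (auto simp: K_def alg_gen.gen)
    then have "insert g U \<notin> F" using U(2)[of "insert g U"] by auto
    then obtain y where "y \<in> alg_gen c (insert g U)" "y \<in> Q" "y \<noteq> 0"
      using U(1) g(1) by (auto simp: F_def)
    then obtain p where "\<forall>i. coeff p i \<in> K" "y = poly p g"
      unfolding alg_gen_insert[OF c] adjoin_def K_def by blast
    then have p: "\<forall>i. coeff p i \<in> K" "p \<noteq> 0" "poly p g \<in> Q"
      using \<open>y \<in> Q\<close> \<open>y \<noteq> 0\<close> by auto
    let ?R = "\<lambda>p. (\<forall>i. coeff p i \<in> K) \<and> p \<noteq> 0 \<and> poly p g \<in> Q"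
    \<comment> \<open>\<open>q\<close> is a relation of least degree of \<open>g\<close> modulo
      \<open>Q\<close>, so its derivative is not one. As \<open>\<delta>\<close> kills
      \<open>K\<close> and preserves \<open>Q\<close>, the chain rule gives
      \<open>poly (pderiv q) g * \<delta> g \<in> Q\<close>, against primality.\<close>
    obtain q where q: "?R q" "\<And>r. ?R r \<Longrightarrow> degree q \<le> degree r"
      using ex_has_least_nat[of ?R p degree] p by blast
    have deg: "degree q > 0"
    proof (rule ccontr)
      assume "\<not> degree q > 0"
      then obtain a where a: "q = [:a:]" using degree_eq_zeroE by blast
      with q have "a \<in> K" "a \<in> Q" "a \<noteq> 0" by (auto dest: spec[of _ 0])
      with KQ show False by blast
    qed
    have "coeff (pderiv q) (degree q - 1) = of_nat (degree q) * lead_coeff q"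
      using deg by (simp add: coeff_pderiv)
    moreover have "(of_nat (degree q) :: 'x) \<noteq> 0" using of_nat_unit[OF c deg] by auto
    ultimately have "pderiv q \<noteq> 0" using q deg by auto
    moreover have "\<forall>i. coeff (pderiv q) i \<in> K"
      using q K.of_nat_mem[of "Suc _"] by (auto simp only: coeff_pderiv intro!: K.mult_mem)
    moreover have "degree (pderiv q) < degree q"
      using degree_pderiv_le[of q] deg by linarith
    ultimately have notin: "poly (pderiv q) g \<notin> Q" using q(2)[of "pderiv q"] by fastforce
    have chain: "\<delta> (poly r g) = poly (pderiv r) g * \<delta> g" if "\<forall>i. coeff r i \<in> K" for r
      using that
    proof (induction r)
      case 0
      then show ?case using \<delta>K[OF K.zero_mem] by simp
    next
      case (pCons a r)
      have "a \<in> K" using pCons.prems by (metis coeff_pCons_0)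
      moreover have "\<forall>i. coeff r i \<in> K" using pCons.prems by (metis coeff_pCons_Suc)
      ultimately show ?case
        using pCons.IH \<delta>K[of a]
        by (simp add: derivation_on_add[OF der] derivation_on_mult[OF der] pderiv_pCons algebra_simps)
    qed
    have "poly (pderiv q) g * \<delta> g \<in> Q" using \<delta>Q[of "poly q g"] q chain by simp
    then show False using mult_notin[OF notin \<delta>g] by simp
  qed
  moreover have "\<delta> (c z) = 0" for z by (intro \<delta>K) (simp add: K_def alg_gen.scalar)
  ultimately show ?thesis using der by blast
qed

end

subsection \<open>Symbols of differential operators\<close>

text \<open>The commutator of \<open>\<theta>\<close> with multiplication by \<open>f\<close>. Its
  \<open>m\<close>-fold iterate on an operator of order at most \<open>m\<close> is multiplication
  by \<open>m!\<close> times the principal symbol at the differential of \<open>f\<close>.\<close>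

definition ad :: "'x::comm_ring_1 \<Rightarrow> ('x \<Rightarrow> 'x) \<Rightarrow> 'x \<Rightarrow> 'x" where
  "ad f \<theta> = (\<lambda>g. \<theta> (f * g) - f * \<theta> g)"

lemma ad_pow_add: "(ad f ^^ n) (\<lambda>g. \<theta> g + \<eta> g) = (\<lambda>g. (ad f ^^ n) \<theta> g + (ad f ^^ n) \<eta> g)"
  by (induction n) (auto simp: ad_def algebra_simps)

lemma ad_pow_diff: "(ad f ^^ n) (\<lambda>g. \<theta> g - \<eta> g) = (\<lambda>g. (ad f ^^ n) \<theta> g - (ad f ^^ n) \<eta> g)"
  by (induction n) (auto simp: ad_def algebra_simps)

lemma ad_pow_mult: "(ad f ^^ n) (\<lambda>g. h * \<theta> g) = (\<lambda>g. h * (ad f ^^ n) \<theta> g)"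
  by (induction n) (auto simp: ad_def algebra_simps)

lemma ad_pow_sum:
  "(ad f ^^ n) (\<lambda>g. \<Sum>j\<in>J. \<theta> j g) = (\<lambda>g. \<Sum>j\<in>J. (ad f ^^ n) (\<theta> j) g)"
  by (induction n) (auto simp: ad_def sum_subtractf sum_distrib_left)

lemma ad_commute: "ad f (ad g \<theta>) = ad g (ad f \<theta>)"
  by (auto simp: ad_def algebra_simps)

lemma ad_pow_commute: "(ad f ^^ n) (ad g \<theta>) = ad g ((ad f ^^ n) \<theta>)"
  by (induction n) (auto simp: ad_commute[of f g])

lemma ad_comp:
  "ad f (\<lambda>g. \<theta> (\<eta> g)) = (\<lambda>g. ad f \<theta> (\<eta> g) + \<theta> (f * \<eta> g + ad f \<eta> g) - \<theta> (f * \<eta> g))"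
  by (auto simp: ad_def algebra_simps)

lemma diffop_le_Suc_iff: "diffop_le c (Suc n) \<theta> \<longleftrightarrow> C_linear c \<theta> \<and> (\<forall>f. diffop_le c n (ad f \<theta>))"
  by (simp add: ad_def)

declare diffop_le.simps [simp del]

lemma diffop_le_linear: "diffop_le c n \<theta> \<Longrightarrow> C_linear c \<theta>"
  by (cases n) (auto simp: diffop_le_Suc_iff diffop_le.simps(1))

lemma diffop_le_0_eq: "diffop_le c 0 \<theta> \<Longrightarrow> \<theta> g = g * \<theta> 1"
  unfolding diffop_le.simps(1) by (metis mult.right_neutral)

lemma diffop_le_0_ad: "diffop_le c 0 \<theta> \<Longrightarrow> ad f \<theta> = (\<lambda>_. 0)"
  by (auto simp: ad_def diffop_le.simps(1))

lemma C_linear_add: "C_linear c \<theta> \<Longrightarrow> \<theta> (f + g) = \<theta> f + \<theta> g"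
  by (simp add: C_linear_def)

lemma C_linear_comp: "C_linear c \<theta> \<Longrightarrow> C_linear c \<eta> \<Longrightarrow> C_linear c (\<lambda>g. \<theta> (\<eta> g))"
  by (simp add: C_linear_def)

lemma diffop_le_zero: "diffop_le c n (\<lambda>_. 0)"
  by (induction n) (auto simp: diffop_le_Suc_iff diffop_le.simps(1) C_linear_def ad_def)

lemma diffop_le_add:
  "diffop_le c n \<theta> \<Longrightarrow> diffop_le c n \<eta> \<Longrightarrow> diffop_le c n (\<lambda>g. \<theta> g + \<eta> g)"
proof (induction n arbitrary: \<theta> \<eta>)
  case 0
  then show ?case by (auto simp: diffop_le.simps(1) C_linear_def algebra_simps)
next
  case (Suc n)
  have "ad f (\<lambda>g. \<theta> g + \<eta> g) = (\<lambda>g. ad f \<theta> g + ad f \<eta> g)" for f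
    using ad_pow_add[of 1 f \<theta> \<eta>] by simp
  with Suc show ?case by (auto simp: diffop_le_Suc_iff C_linear_def algebra_simps)
qed

lemma diffop_le_comp:
  assumes "diffop_le c p \<theta>" "diffop_le c q \<eta>"
  shows "diffop_le c (p + q) (\<lambda>g. \<theta> (\<eta> g))"
  using assms
proof (induction "p + q" arbitrary: p q \<theta> \<eta>)
  case 0
  then show ?case by (auto simp: diffop_le.simps(1) C_linear_def)
next
  case (Suc n)
  note lin = diffop_le_linear[OF Suc.prems(1)] diffop_le_linear[OF Suc.prems(2)]
  have "diffop_le c n (\<lambda>g. ad f \<theta> (\<eta> g))" for f
  proof (cases p)
    case 0
    then show ?thesis using Suc.prems by (simp add: diffop_le_0_ad diffop_le_zero)
  next
    case (Suc p')
    then show ?thesis using Suc.hyps(1)[of p' q "ad f \<theta>" \<eta>] Suc.hyps(2) Suc.prems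
      by (simp add: diffop_le_Suc_iff)
  qed
  moreover have "diffop_le c n (\<lambda>g. \<theta> (ad f \<eta> g))" for f
  proof (cases q)
    case 0
    have "\<theta> 0 = 0" using C_linear_add[OF lin(1), of 0 0] by (metis add_0 add_cancel_right_left)
    then show ?thesis using 0 Suc.prems by (simp add: diffop_le_0_ad diffop_le_zero)
  next
    case (Suc q')
    then show ?thesis using Suc.hyps(1)[of p q' \<theta> "ad f \<eta>"] Suc.hyps(2) Suc.prems
      by (simp add: diffop_le_Suc_iff)
  qed
  moreover have "ad f (\<lambda>g. \<theta> (\<eta> g)) = (\<lambda>g. ad f \<theta> (\<eta> g) + \<theta> (ad f \<eta> g))" for f
    unfolding ad_comp by (simp add: C_linear_add[OF lin(1)])
  ultimately have "diffop_le c (Suc n) (\<lambda>g. \<theta> (\<eta> g))"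
    using C_linear_comp[OF lin] by (simp add: diffop_le_Suc_iff diffop_le_add)
  then show ?case using Suc.hyps(2) by simp
qed

lemma diffop_le_ad_pow: "diffop_le c (n + k) \<theta> \<Longrightarrow> diffop_le c n ((ad f ^^ k) \<theta>)"
  by (induction k arbitrary: \<theta>) (auto simp: diffop_le_Suc_iff funpow_Suc_right simp del: funpow.simps)

lemma ad_pow_eq_0: "diffop_le c n \<theta> \<Longrightarrow> (ad f ^^ Suc n) \<theta> = (\<lambda>_. 0)"
  using diffop_le_ad_pow[of c 0 n \<theta> f] diffop_le_0_ad by fastforce

text \<open>Polarised in one slot, the principal symbol is a derivation.\<close>
lemma derivation_ad_pow:
  assumes "diffop_le c (Suc n) \<theta>"
  shows "derivation_on UNIV (\<lambda>f. (ad y ^^ n) (ad f \<theta>) 1)"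
  unfolding derivation_on_def
proof (intro ballI conjI)
  fix f g
  have lin: "C_linear c \<theta>" using assms by (rule diffop_le_linear)
  have "ad (f + g) \<theta> = (\<lambda>h. ad f \<theta> h + ad g \<theta> h)"
    by (auto simp: ad_def distrib_right C_linear_add[OF lin])
  then show "(ad y ^^ n) (ad (f + g) \<theta>) 1 = (ad y ^^ n) (ad f \<theta>) 1 + (ad y ^^ n) (ad g \<theta>) 1"
    by (simp add: ad_pow_add)
  have "ad (f * g) \<theta> = (\<lambda>h. (f * ad g \<theta> h + g * ad f \<theta> h) + ad g (ad f \<theta>) h)"
    by (auto simp: ad_def algebra_simps)
  moreover have "(ad y ^^ n) (ad g (ad f \<theta>)) = (\<lambda>_. 0)"
    unfolding ad_pow_commute[of n y g]
    using assms diffop_le_ad_pow[of c 0 n "ad f \<theta>" y] diffop_le_0_ad[of c]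
    by (simp add: diffop_le_Suc_iff)
  ultimately show "(ad y ^^ n) (ad (f * g) \<theta>) 1 =
      f * (ad y ^^ n) (ad g \<theta>) 1 + g * (ad y ^^ n) (ad f \<theta>) 1"
    by (simp add: ad_pow_add ad_pow_mult)
qed

text \<open>Symbols multiply. A \<open>p\<close>-fold commutator carries a factor \<open>p!\<close>,
  which accounts for the binomial coefficient; the induction combines the Leibniz rule for
  \<open>ad f\<close> with Pascal's rule.\<close>

lemma ad_pow_comp:
  assumes "diffop_le c p \<theta>" "diffop_le c q \<eta>"
  shows "(ad f ^^ (p + q)) (\<lambda>g. \<theta> (\<eta> g)) 1 =
    of_nat ((p + q) choose p) * ((ad f ^^ p) \<theta> 1 * (ad f ^^ q) \<eta> 1)"
  using assms
proof (induction "p + q" arbitrary: p q \<theta> \<eta>)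
  case 0
  then show ?case using diffop_le_0_eq[of c \<theta> "\<eta> 1"] by (simp add: mult.commute)
next
  case (Suc n)
  note lin = diffop_le_linear[OF Suc.prems(1)] diffop_le_linear[OF Suc.prems(2)]
  have ad_comp': "ad f (\<lambda>g. \<theta> (\<eta> g)) = (\<lambda>g. ad f \<theta> (\<eta> g) + \<theta> (ad f \<eta> g))"
    unfolding ad_comp by (simp add: C_linear_add[OF lin(1)])
  have \<theta>0: "\<theta> 0 = 0"
    using C_linear_add[OF lin(1), of 0 0] by (metis add_0 add_cancel_right_left)
  have split: "(ad f ^^ (p + q)) (\<lambda>g. \<theta> (\<eta> g)) 1 =
      (ad f ^^ n) (\<lambda>g. ad f \<theta> (\<eta> g)) 1 + (ad f ^^ n) (\<lambda>g. \<theta> (ad f \<eta> g)) 1"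
    unfolding Suc.hyps(2)[symmetric] funpow_Suc_right by (simp add: ad_comp' ad_pow_add)
  have zero: "(ad f ^^ n) (\<lambda>_. 0) 1 = 0" using ad_pow_mult[of n f 0 "\<lambda>_. 0"] by (simp add: fun_eq_iff)
  have left: "(ad f ^^ n) (\<lambda>g. ad f \<theta> (\<eta> g)) 1 =
      of_nat (n choose p') * ((ad f ^^ p) \<theta> 1 * (ad f ^^ q) \<eta> 1)" if "p = Suc p'" for p'
    using Suc.hyps(1)[of p' q "ad f \<theta>" \<eta>] Suc.hyps(2) Suc.prems that
    by (simp add: diffop_le_Suc_iff funpow_Suc_right del: funpow.simps)
  have right: "(ad f ^^ n) (\<lambda>g. \<theta> (ad f \<eta> g)) 1 =
      of_nat (n choose p) * ((ad f ^^ p) \<theta> 1 * (ad f ^^ q) \<eta> 1)" if "q = Suc q'" for q'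
    using Suc.hyps(1)[of p q' \<theta> "ad f \<eta>"] Suc.hyps(2) Suc.prems that
    by (simp add: diffop_le_Suc_iff funpow_Suc_right del: funpow.simps)
  show ?case
  proof (cases p)
    case 0
    then obtain q' where q': "q = Suc q'" using Suc.hyps(2) by auto
    have "ad f \<theta> = (\<lambda>_. 0)" using 0 Suc.prems by (simp add: diffop_le_0_ad)
    then show ?thesis unfolding split using right[OF q'] zero 0 by simp
  next
    case p': (Suc p')
    show ?thesis
    proof (cases q)
      case 0
      have "ad f \<eta> = (\<lambda>_. 0)" using 0 Suc.prems by (simp add: diffop_le_0_ad)
      moreover have "n = p'" using Suc.hyps(2) p' 0 by simp
      ultimately show ?thesis unfolding split using left[OF p'] zero \<theta>0 0 p' by simp
    next
      case q': (Suc q')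
      have "(p + q) choose p = (n choose p') + (n choose p)"
        using Suc.hyps(2) by (simp add: p')
      then show ?thesis unfolding split left[OF p'] right[OF q'] by (simp add: distrib_right)
    qed
  qed
qed

lemma derivation_diffop_le:
  assumes D: "derivation_on UNIV D" and Dc: "\<And>z. D (c z) = 0"
  shows "diffop_le c 1 D"
proof -
  have "C_linear c D"
    by (simp add: C_linear_def derivation_on_add[OF D] derivation_on_mult[OF D] Dc)
  moreover have "ad f D = (\<lambda>g. D f * g)" for f
    by (auto simp: ad_def derivation_on_mult[OF D])
  ultimately show ?thesis
    by (auto simp: One_nat_def diffop_le_Suc_iff diffop_le.simps(1) C_linear_def algebra_simps)
qed

lemma derivation_funpow_symbol:
  fixes D :: "'x::idom \<Rightarrow> 'x"
  assumes D: "derivation_on UNIV D" and Dc: "\<And>z. D (c z) = 0"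
  shows "diffop_le c n (D ^^ n) \<and> (ad f ^^ n) (D ^^ n) 1 = of_nat (fact n) * D f ^ n"
proof (induction n)
  case 0
  then show ?case by (auto simp: diffop_le.simps(1) C_linear_def)
next
  case (Suc n)
  note D1 = derivation_diffop_le[OF D Dc]
  have "D 1 = 0" using unital_subring.derivation_on_one[OF unital_subring_UNIV D] .
  then have symD: "(ad f ^^ 1) D 1 = D f" by (simp add: ad_def)
  have comp: "D ^^ Suc n = (\<lambda>g. D ((D ^^ n) g))" by auto
  have "(ad f ^^ (1 + n)) (\<lambda>g. D ((D ^^ n) g)) 1 =
      of_nat ((1 + n) choose 1) * (D f * (of_nat (fact n) * D f ^ n))"
    unfolding ad_pow_comp[OF D1 conjunct1[OF Suc]] symD using Suc by simp
  moreover have "diffop_le c (1 + n) (\<lambda>g. D ((D ^^ n) g))"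
    using Suc by (intro diffop_le_comp D1) simp
  ultimately show ?case unfolding comp by (simp add: algebra_simps)
qed

section \<open>Orders of symbols along a height-one prime\<close>

context uniformizer begin

text \<open>Substituting the first decomposition into the second multiplies exponents. For
  \<open>z\<close> in \<open>S\<close> this turns its exponent at \<open>P\<close> into its value at
  a prime above, with the ramification index as factor.\<close>

lemma vge_of_product:
  assumes "s * y = x ^ r * t" "s \<notin> Q" "t \<notin> Q" "s' * z = y ^ m * t'" "s' \<notin> Q" "t' \<notin> Q"
  shows "vge n z \<longleftrightarrow> n \<le> r * m"
proof -
  have power_notin: "u ^ k \<notin> Q" if "u \<notin> Q" for u k
    using that by (induction k) (auto simp: one_notin mult_notin)
  have "(s ^ m * s') * z = s ^ m * (y ^ m * t')" using assms(4) by (simp add: mult.assoc)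
  also have "\<dots> = (s * y) ^ m * t'" by (simp add: power_mult_distrib mult_ac)
  also have "\<dots> = x ^ (r * m) * (t ^ m * t')"
    unfolding assms(1) power_mult by (simp add: power_mult_distrib mult_ac)
  finally show ?thesis by (rule vge_exact) (use assms in \<open>auto simp: mult_notin power_notin\<close>)
qed

lemma unit_notin:
  assumes "is_C_embedding (c :: complex \<Rightarrow> 'x)" "n > 0" shows "of_nat n \<notin> Q"
  using of_nat_unit[OF assms] mult_mem_left[of "of_nat n"] one_notin by metis

lemma derivation_transfer:
  assumes E: "derivation_on UNIV E" and y: "s * y = x ^ Suc k * t"
  shows "s * E y + y * E s = x ^ Suc k * E t + t * (of_nat (Suc k) * x ^ k * E x)"
  using arg_cong[OF y, of E] derivation_power[OF E, of x k]
  by (simp add: derivation_on_mult[OF E] del: power_Suc of_nat_Suc)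

text \<open>Here \<open>y\<close> has value \<open>k + 1\<close>, and each commutator with
  \<open>y\<close> contributes at least \<open>k\<close>: differentiating the relation between
  \<open>y\<close> and \<open>x\<close> loses one power of \<open>x\<close>.\<close>

lemma vge_symbol:
  assumes y: "s * y = x ^ Suc k * t" "s \<notin> Q" "t \<notin> Q"
  shows "diffop_le c n \<theta> \<Longrightarrow> vge (k * n) ((ad y ^^ n) \<theta> 1)"
proof (induction n arbitrary: \<theta>)
  case 0
  then show ?case by (simp add: vge_0)
next
  case (Suc n)
  \<comment> \<open>One commutator with \<open>y\<close> is freed, so that the symbol becomes a
    derivation in that slot and the relation for \<open>y\<close> can be differentiated.\<close>
  define E where "E = (\<lambda>f. (ad y ^^ n) (ad f \<theta>) 1)"
  have der: "derivation_on UNIV E" unfolding E_def by (rule derivation_ad_pow[OF Suc.prems])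
  have E: "vge (k * n) (E f)" for f
    unfolding E_def using Suc.prems by (intro Suc.IH) (simp add: diffop_le_Suc_iff)
  have yk: "vge k y" using vge_exact[OF y] by simp
  have xk: "vge k (x ^ Suc k)" "vge k (x ^ k)" by (auto intro!: vge_dvd le_imp_power_dvd)
  have "s * E y = x ^ Suc k * E t + t * of_nat (Suc k) * (x ^ k * E x) - y * E s"
    using derivation_transfer[OF der y(1)] by (simp add: algebra_simps)
  also have "vge (k + k * n) \<dots>"
    by (intro vge_diff vge_add vge_mult_left[of _ _ "t * of_nat (Suc k)"] vge_mult yk xk E)
  finally have "vge (k + k * n) (E y)" using vge_cancel_unit y(2) by blast
  then show ?case by (simp add: E_def funpow_Suc_right del: funpow.simps)
qed

text \<open>Commutators with \<open>y\<close> are exchanged for commutators with \<open>x\<close>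
  one at a time: \<open>j\<close> counts those left and \<open>i\<close> those done. Each exchange
  lowers the bound by \<open>k\<close>, and the excess of one survives to the end.\<close>

lemma symbol_descend:
  assumes c: "is_C_embedding c" and y: "s * y = x ^ Suc k * t" "s \<notin> Q" "t \<notin> Q"
  shows "diffop_le c (j + i) \<theta> \<Longrightarrow> vge (k * j + 1) ((ad y ^^ j) ((ad x ^^ i) \<theta>) 1) \<Longrightarrow>
    vge 1 ((ad x ^^ (i + j)) \<theta> 1)"
proof (induction j arbitrary: i)
  case 0
  then show ?case by simp
next
  case (Suc j)
  define \<eta> where "\<eta> = (ad x ^^ i) \<theta>"
  define E where "E = (\<lambda>f. (ad y ^^ j) (ad f \<eta>) 1)"
  have \<eta>: "diffop_le c (Suc j) \<eta>"
    unfolding \<eta>_def using Suc.prems(1) by (rule diffop_le_ad_pow)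
  have der: "derivation_on UNIV E" unfolding E_def by (rule derivation_ad_pow[OF \<eta>])
  have E: "vge (k * j) (E f)" for f
    unfolding E_def using \<eta> by (intro vge_symbol[OF y, of c]) (simp add: diffop_le_Suc_iff)
  have yk: "vge (Suc k) y" using vge_exact[OF y] by simp
  have xk: "vge (Suc k) (x ^ Suc k)" by (rule vge_dvd) simp
  have Ey: "vge (Suc k + k * j) (E y)"
    using Suc.prems(2) by (simp add: E_def \<eta>_def funpow_Suc_right del: funpow.simps)
  \<comment> \<open>All three terms on the right have value at least \<open>Suc k + k * j\<close>,
    the first by hypothesis; dividing by the local unit \<open>t * of_nat (Suc k)\<close> and by
    \<open>x ^ k\<close> leaves one more than \<open>k * j\<close>.\<close>
  have "(t * of_nat (Suc k)) * (x ^ k * E x) = s * E y + y * E s - x ^ Suc k * E t"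
    using derivation_transfer[OF der y(1)] by (simp add: algebra_simps)
  also have "vge (Suc k + k * j) \<dots>"
    by (intro vge_diff vge_add vge_mult_left[OF Ey] vge_mult yk xk E)
  finally have "vge (Suc k + k * j) (x ^ k * E x)"
    using vge_cancel_unit mult_notin[OF y(3) unit_notin[OF c, of "Suc k"]] by blast
  then have "vge (k * j + 1) (E x)" using vge_cancel_power[of k "k * j + 1"] by simp
  then have "vge 1 ((ad x ^^ (Suc i + j)) \<theta> 1)"
    using Suc.prems(1) by (intro Suc.IH) (auto simp: E_def \<eta>_def)
  then show ?case by simp
qed

lemma symbol_in_prime:
  assumes "is_C_embedding c" "s * y = x ^ Suc k * t" "s \<notin> Q" "t \<notin> Q" "diffop_le c n \<theta>"
    "vge (k * n + 1) ((ad y ^^ n) \<theta> 1)"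
  shows "(ad x ^^ n) \<theta> 1 \<in> Q"
  using symbol_descend[OF assms(1-4), of n 0 \<theta>] assms(5,6) vge_1_iff by simp

end

lemma height_one_uniformizer_UNIV:
  fixes Q :: "'x::idom set"
  assumes "noetherian_set (UNIV :: 'x set)" "normal_domain (UNIV :: 'x set)" "height_one_in UNIV Q"
  obtains x where "uniformizer Q x"
proof -
  obtain x where x: "x \<in> Q" "x \<noteq> 0"
    "\<forall>f. f \<noteq> 0 \<longrightarrow> (\<exists>n. \<exists>s\<in>UNIV - Q. \<exists>t\<in>UNIV - Q. s * f = x ^ n * t)"
    using unital_subring.height_one_uniformizer[OF unital_subring_UNIV assms] by auto
  have "uniformizer Q x"
  proof
    show "prime_in UNIV Q" using assms(3) by (simp add: height_one_in_def)
    show "\<exists>n s t. s \<notin> Q \<and> t \<notin> Q \<and> s * f = x ^ n * t" if "f \<noteq> 0" for f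
      using x(3) that by (metis DiffD2)
  qed (use x in auto)
  then show thesis by (rule that)
qed

lemma D_subalgebra_ad:
  assumes c: "is_C_embedding c" and A: "D_subalgebra c A" and y: "mult_op y \<in> A"
  shows "\<theta> \<in> A \<Longrightarrow> (ad y ^^ n) \<theta> \<in> A"
proof (induction n)
  case (Suc n)
  let ?\<eta> = "(ad y ^^ n) \<theta>"
  have cm: "c (- 1) = - 1" using C_embedding_uminus[OF c, of 1] c by (simp add: is_C_embedding_def)
  have closed: "(\<lambda>g. \<theta> g + \<eta> g) \<in> A" "\<theta> \<circ> \<eta> \<in> A" "(\<lambda>g. c z * \<theta> g) \<in> A"
    if "\<theta> \<in> A" "\<eta> \<in> A" for \<theta> \<eta> z
    using A that by (auto simp: D_subalgebra_def)
  have "?\<eta> \<in> A" using Suc by simp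
  then have "(\<lambda>g. (?\<eta> \<circ> mult_op y) g + c (- 1) * (mult_op y \<circ> ?\<eta>) g) \<in> A"
    using y by (intro closed(1) closed(2) closed(3)[of _ "mult_op y"])
  moreover have "(\<lambda>g. (?\<eta> \<circ> mult_op y) g + c (- 1) * (mult_op y \<circ> ?\<eta>) g) = ad y ?\<eta>"
    unfolding ad_def[of y ?\<eta>] mult_op_def cm by simp
  ultimately show ?case by simp
qed simp

lemma order_zero_part:
  assumes int: "A \<inter> range mult_op = mult_op ` S" and "\<theta> \<in> A" "diffop_le c 0 \<theta>"
  shows "\<theta> 1 \<in> S"
proof -
  have "\<theta> = mult_op (\<theta> 1)"
    unfolding mult_op_def using diffop_le_0_eq[OF assms(3)] by (intro ext) (metis mult.commute)
  then have "\<theta> \<in> mult_op ` S" using assms(2) int by blast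
  then show ?thesis by (auto simp: mult_op_def)
qed

subsection \<open>Finiteness and ramification\<close>

text \<open>In degree zero, agreement modulo lower order is equality and the coefficients have order
  zero, hence come from \<open>S\<close>. Evaluating at 1 exhibits the values \<open>s j 1\<close>
  as module generators.\<close>

lemma graded_cofinite_finite_morphism:
  assumes c: "is_C_embedding c" and S: "unital_subring S"
    and cof: "graded_cofinite c A" and int: "A \<inter> range mult_op = mult_op ` S"
  shows "finite_morphism S"
proof -
  interpret unital_subring S by fact
  obtain J :: "nat set" and s dj where J: "finite J" "\<forall>j\<in>J. diffop_le c (dj j) (s j)"
    "\<forall>d \<theta>. diffop_le c d \<theta> \<longrightarrow> (\<exists>a. (\<forall>j\<in>J. a j \<in> A \<and> (dj j \<le> d \<longrightarrow> diffop_le c (d - dj j) (a j))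
        \<and> (d < dj j \<longrightarrow> a j = (\<lambda>_. 0))) \<and> diffop_lt c d (\<lambda>g. \<theta> g - (\<Sum>j\<in>J. a j (s j g))))"
    using cof unfolding graded_cofinite_def by (elim exE conjE) (rule that)
  define F where "F = (\<lambda>j. s j 1) ` J"
  have "\<exists>co. (\<forall>f\<in>F. co f \<in> S) \<and> r = (\<Sum>f\<in>F. co f * f)" for r
  proof -
    have "C_linear c (mult_op r)" by (simp add: C_linear_def mult_op_def algebra_simps)
    then have "diffop_le c 0 (mult_op r)"
      by (simp add: diffop_le.simps(1) mult_op_def mult_ac)
    with J(3) obtain a where a: "\<forall>j\<in>J. a j \<in> A \<and> (dj j \<le> 0 \<longrightarrow> diffop_le c (0 - dj j) (a j))
        \<and> (0 < dj j \<longrightarrow> a j = (\<lambda>_. 0))"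
      "diffop_lt c 0 (\<lambda>g. mult_op r g - (\<Sum>j\<in>J. a j (s j g)))" by blast
    have a0: "diffop_le c 0 (a j)" if "j \<in> J" for j
      using bspec[OF a(1) that] diffop_le_zero[of c 0] by (cases "dj j = 0") auto
    have aS: "a j 1 \<in> S" if "j \<in> J" for j
      using order_zero_part[OF int _ a0] a(1) that by blast
    have "mult_op r 1 - (\<Sum>j\<in>J. a j (s j 1)) = 0"
      using a(2) unfolding diffop_lt_def by (simp add: fun_eq_iff)
    then have "r = (\<Sum>j\<in>J. a j (s j 1))" by (simp add: mult_op_def)
    also have "\<dots> = (\<Sum>j\<in>J. a j 1 * s j 1)"
      using a0 by (intro sum.cong refl) (metis diffop_le_0_eq mult.commute)
    \<comment> \<open>Distinct indices may give the same generator \<open>s j 1\<close>, so the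
      coefficients are collected over each fibre.\<close>
    also have "\<dots> = (\<Sum>f\<in>F. \<Sum>j\<in>{j\<in>J. s j 1 = f}. a j 1 * s j 1)"
      unfolding F_def by (rule sum.image_gen[OF J(1)])
    also have "\<dots> = (\<Sum>f\<in>F. (\<Sum>j\<in>{j\<in>J. s j 1 = f}. a j 1) * f)"
      unfolding sum_distrib_right by (intro sum.cong) auto
    finally show ?thesis using aS
      by (intro exI[of _ "\<lambda>f. \<Sum>j\<in>{j\<in>J. s j 1 = f}. a j 1"]) (auto intro!: sum_mem)
  qed
  moreover have "finite F" unfolding F_def using J(1) by simp
  ultimately show ?thesis unfolding finite_morphism_def by blast
qed

section \<open>Nakayama's lemma and surjectivity of finite morphisms\<close>

lemma (in unital_subring) nakayama_elimination:
  assumes m: "ideal_in S m" and "finite F"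
    and "\<And>f. f \<in> F \<Longrightarrow> \<exists>u k. u \<in> S \<and> u - 1 \<in> m \<and> (\<forall>h\<in>F. k h \<in> m) \<and> u * f = (\<Sum>h\<in>F. k h * h)"
  shows "\<exists>u\<in>S. u - 1 \<in> m \<and> (\<forall>f\<in>F. u * f = 0)"
  using assms(2,3)
proof (induction F rule: finite_induct)
  case empty
  then show ?case using one_mem m by (intro bexI[of _ 1]) (auto simp: ideal_in_def)
next
  case (insert f0 F)
  have mS: "a \<in> S" if "a \<in> m" for a using that m by (auto simp: ideal_in_def)
  have one_plus_m: "u * v - 1 \<in> m" if "u \<in> S" "u - 1 \<in> m" "v - 1 \<in> m" for u v
    using ideal_in_add[OF m ideal_in_mult[OF m that(3,1)] that(2)] by (simp add: algebra_simps)
  obtain u0 k0 where 0: "u0 \<in> S" "u0 - 1 \<in> m" "\<And>h. h \<in> insert f0 F \<Longrightarrow> k0 h \<in> m"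
    "u0 * f0 = (\<Sum>h\<in>insert f0 F. k0 h * h)"
    using insert.prems[of f0] by auto
  \<comment> \<open>Moving the diagonal term to the left leaves the coefficient \<open>v0\<close>,
    still 1 modulo \<open>m\<close>. Multiplying the other equations by \<open>v0\<close> then
    eliminates \<open>f0\<close>, in place of a determinant.\<close>
  define v0 where "v0 = u0 - k0 f0"
  have v0: "v0 \<in> S" "v0 - 1 \<in> m" "v0 * f0 = (\<Sum>h\<in>F. k0 h * h)"
  proof -
    show "v0 \<in> S" unfolding v0_def using 0(1,3) mS by (intro diff_mem) auto
    show "v0 - 1 \<in> m"
      using ideal_in_add[OF m 0(2) ideal_uminus[OF m 0(3)[of f0]]] by (simp add: v0_def algebra_simps)
    show "v0 * f0 = (\<Sum>h\<in>F. k0 h * h)"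
      using 0(4) insert.hyps by (simp add: v0_def left_diff_distrib)
  qed
  have "\<exists>u k. u \<in> S \<and> u - 1 \<in> m \<and> (\<forall>h\<in>F. k h \<in> m) \<and> u * f = (\<Sum>h\<in>F. k h * h)" if "f \<in> F" for f
  proof -
    obtain u1 k1 where 1: "u1 \<in> S" "u1 - 1 \<in> m" "\<And>h. h \<in> insert f0 F \<Longrightarrow> k1 h \<in> m"
      "u1 * f = (\<Sum>h\<in>insert f0 F. k1 h * h)"
      using insert.prems[of f] \<open>f \<in> F\<close> by auto
    have "(v0 * u1) * f = v0 * (k1 f0 * f0 + (\<Sum>h\<in>F. k1 h * h))"
      using 1(4) insert.hyps by (simp add: mult.assoc)
    also have "\<dots> = k1 f0 * (v0 * f0) + v0 * (\<Sum>h\<in>F. k1 h * h)" by (simp add: algebra_simps)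
    also have "\<dots> = (\<Sum>h\<in>F. (k1 f0 * k0 h + v0 * k1 h) * h)"
      unfolding v0(3) by (simp add: sum_distrib_left sum.distrib distrib_right mult.assoc)
    finally have "(v0 * u1) * f = (\<Sum>h\<in>F. (k1 f0 * k0 h + v0 * k1 h) * h)" .
    moreover have "k1 f0 * k0 h + v0 * k1 h \<in> m" if "h \<in> F" for h
      using 0(3)[of h] 1(3)[of h] 1(3)[of f0] v0(1) mS that
      by (intro ideal_in_add[OF m] ideal_in_mult[OF m]) auto
    moreover have "v0 * u1 \<in> S" "v0 * u1 - 1 \<in> m"
      using v0 1 mult_mem one_plus_m by blast+
    ultimately show ?thesis
      by (intro exI[of _ "v0 * u1"] exI[of _ "\<lambda>h. k1 f0 * k0 h + v0 * k1 h"]) simp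
  qed
  from insert.IH[OF this] obtain u where u: "u \<in> S" "u - 1 \<in> m" "\<forall>f\<in>F. u * f = 0" by blast
  have "(u * v0) * f0 = (\<Sum>h\<in>F. k0 h * (u * h))"
    using v0(3) by (simp add: mult.assoc sum_distrib_left mult.left_commute)
  also have "\<dots> = 0" using u(3) by (intro sum.neutral ballI) (metis mult_zero_right)
  finally have "(u * v0) * f0 = 0" .
  moreover have "(u * v0) * f = 0" if "f \<in> F" for f
    using u that by (metis mult.commute mult.left_commute mult_zero_right)
  ultimately have "\<forall>f\<in>insert f0 F. (u * v0) * f = 0" by blast
  then show ?case using u v0 mult_mem one_plus_m by blast
qed

text \<open>The extension of \<open>m\<close> is proper by Nakayama's lemma, so it lies in a maximal
  ideal of the larger ring; this contracts to a proper ideal containing \<open>m\<close>, hence to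
  \<open>m\<close>.\<close>

lemma finite_morphism_surjective:
  fixes S :: "'x::idom set"
  assumes S: "unital_subring S" and noeth: "noetherian_set (UNIV :: 'x set)"
    and fin: "finite_morphism S"
  shows "surjective_morphism S"
  unfolding surjective_morphism_def
proof (intro allI impI)
  interpret unital_subring S by fact
  fix m assume max: "maximal_in S m"
  then have m: "ideal_in S m" and "1 \<notin> m" by (auto simp: maximal_in_def)
  then have mS: "m \<subseteq> S" by (simp add: ideal_in_def)
  obtain F where F: "finite F" "\<And>r. \<exists>co. (\<forall>f\<in>F. co f \<in> S) \<and> r = (\<Sum>f\<in>F. co f * f)"
    using fin unfolding finite_morphism_def by blast
  define J where "J = {\<Sum>f\<in>F. k f * f | k. \<forall>f\<in>F. k f \<in> m}"
  have J: "ideal_in UNIV J"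
    unfolding ideal_in_def
  proof (intro conjI ballI)
    show "0 \<in> J" unfolding J_def using m by (auto intro!: exI[of _ "\<lambda>_. 0"] simp: ideal_in_def)
  next
    fix a b assume "a \<in> J" "b \<in> J"
    then obtain k l where "a = (\<Sum>f\<in>F. k f * f)" "\<forall>f\<in>F. k f \<in> m"
      "b = (\<Sum>f\<in>F. l f * f)" "\<forall>f\<in>F. l f \<in> m" by (auto simp: J_def)
    then show "a + b \<in> J" unfolding J_def
      by (auto intro!: exI[of _ "\<lambda>f. k f + l f"] ideal_in_add[OF m] simp: distrib_right sum.distrib)
  next
    fix a r assume "a \<in> J"
    then obtain k where k: "a = (\<Sum>f\<in>F. k f * f)" "\<forall>f\<in>F. k f \<in> m" by (auto simp: J_def)
    have "\<forall>f. \<exists>co. (\<forall>h\<in>F. co h \<in> S) \<and> r * f = (\<Sum>h\<in>F. co h * h)" using F(2) by blast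
    then obtain co where co: "\<And>f h. h \<in> F \<Longrightarrow> co f h \<in> S" "\<And>f. r * f = (\<Sum>h\<in>F. co f h * h)"
      by metis
    have "r * a = (\<Sum>f\<in>F. k f * (r * f))" unfolding k(1) by (simp add: sum_distrib_left mult_ac)
    also have "\<dots> = (\<Sum>f\<in>F. \<Sum>h\<in>F. co f h * k f * h)"
      unfolding co(2) by (simp add: sum_distrib_left mult_ac)
    also have "\<dots> = (\<Sum>h\<in>F. (\<Sum>f\<in>F. co f h * k f) * h)"
      by (subst sum.swap) (simp add: sum_distrib_right)
    finally show "r * a \<in> J" unfolding J_def using co(1) k(2)
      by (auto intro!: exI[of _ "\<lambda>h. \<Sum>f\<in>F. co f h * k f"] ideal_in_sum[OF m] ideal_in_mult[OF m])
  qed simp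
  obtain co where co: "\<And>f. f \<in> F \<Longrightarrow> co f \<in> S" "1 = (\<Sum>f\<in>F. co f * f)" using F(2)[of 1] by blast
  have mJ: "m \<subseteq> J"
  proof
    fix a assume "a \<in> m"
    have "a = a * (\<Sum>f\<in>F. co f * f)" using co(2) by simp
    also have "\<dots> = (\<Sum>f\<in>F. (co f * a) * f)" by (simp add: sum_distrib_left mult_ac)
    finally have "a = (\<Sum>f\<in>F. (co f * a) * f)" .
    moreover have "\<forall>f\<in>F. co f * a \<in> m" using co(1) \<open>a \<in> m\<close> ideal_in_mult[OF m] by blast
    ultimately show "a \<in> J" unfolding J_def by (auto intro!: exI[of _ "\<lambda>f. co f * a"])
  qed
  have "1 \<notin> J"
  proof
    assume "1 \<in> J"
    have "\<exists>u k. u \<in> S \<and> u - 1 \<in> m \<and> (\<forall>h\<in>F. k h \<in> m) \<and> u * f = (\<Sum>h\<in>F. k h * h)" for f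
    proof -
      have "f * 1 \<in> J" using J \<open>1 \<in> J\<close> by (rule ideal_in_mult) simp
      then obtain k where "\<forall>h\<in>F. k h \<in> m" "1 * f = (\<Sum>h\<in>F. k h * h)" by (auto simp: J_def)
      moreover have "(1::'x) - 1 \<in> m" using m by (simp add: ideal_in_def)
      ultimately show ?thesis using one_mem by (intro exI[of _ 1] exI[of _ k]) simp
    qed
    from nakayama_elimination[OF m F(1) this]
    obtain u where u: "u \<in> S" "u - 1 \<in> m" "\<forall>f\<in>F. u * f = 0" by blast
    have "u = u * (\<Sum>f\<in>F. co f * f)" using co(2) by simp
    also have "\<dots> = (\<Sum>f\<in>F. co f * (u * f))" by (simp add: sum_distrib_left mult_ac)
    also have "\<dots> = 0" using u(3) by (intro sum.neutral ballI) (metis mult_zero_right)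
    finally have "1 \<in> m" using ideal_uminus[OF m u(2)] by simp
    with \<open>1 \<notin> m\<close> show False by simp
  qed
  define \<F> where "\<F> = {I. ideal_in (UNIV :: 'x set) I \<and> J \<subseteq> I \<and> 1 \<notin> I}"
  have "J \<in> \<F>" using J \<open>1 \<notin> J\<close> by (simp add: \<F>_def)
  then have "\<F> \<noteq> {}" by blast
  moreover have "ideal_in UNIV I" if "I \<in> \<F>" for I using that by (simp add: \<F>_def)
  ultimately have "\<exists>M\<in>\<F>. \<forall>I\<in>\<F>. M \<subseteq> I \<longrightarrow> I = M"
    by (rule unital_subring.noetherian_maximal[OF unital_subring_UNIV noeth])
  then obtain M where M: "M \<in> \<F>" "\<And>I. I \<in> \<F> \<Longrightarrow> M \<subseteq> I \<Longrightarrow> I = M" by blast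
  have "maximal_in UNIV M"
    unfolding maximal_in_def
  proof (intro conjI allI impI)
    show "ideal_in UNIV M" "1 \<notin> M" using M(1) by (simp_all add: \<F>_def)
    fix I assume "ideal_in UNIV I \<and> M \<subseteq> I"
    moreover have "J \<subseteq> M" using M(1) by (simp add: \<F>_def)
    ultimately show "I = M \<or> 1 \<in> I" using M(2)[of I] by (auto simp: \<F>_def)
  qed
  moreover have "M \<inter> S = m"
  proof -
    have "ideal_in S (M \<inter> S)"
      using M(1) unfolding \<F>_def ideal_in_def by (simp add: zero_mem add_mem mult_mem)
    moreover have "m \<subseteq> M \<inter> S" "1 \<notin> M \<inter> S" using M(1) mJ mS by (auto simp: \<F>_def)
    ultimately show ?thesis using max unfolding maximal_in_def by blast
  qed
  ultimately show "\<exists>M. maximal_in UNIV M \<and> M \<inter> S = m" by blast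
qed

section \<open>Comparison of ramification indices\<close>

lemma (in uniformizer) ramification_index_eq:
  assumes P: "prime_in S P" "Q \<inter> S = P"
    and y: "y \<in> P" "\<And>f. f \<in> S \<Longrightarrow> f \<noteq> 0 \<Longrightarrow> \<exists>n. \<exists>s\<in>S - P. \<exists>t\<in>S - P. s * f = y ^ n * t"
    and r: "s * y = x ^ r * t" "s \<notin> Q" "t \<notin> Q"
  shows "ramification_index P Q = r"
proof -
  have P': "P \<subseteq> S" "\<And>a b. a \<in> P \<Longrightarrow> b \<in> S \<Longrightarrow> b * a \<in> P"
    using P by (auto simp: prime_in_def ideal_in_def)
  \<comment> \<open>\<open>y\<close> itself bounds \<open>n\<close> by its value \<open>r\<close>;
    every nonzero element of \<open>P\<close> has positive exponent with respect to
    \<open>y\<close>, hence value at least \<open>r\<close>.\<close>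
  have "P \<subseteq> symbolic_power Q n \<longleftrightarrow> n \<le> r" for n
  proof
    assume "P \<subseteq> symbolic_power Q n"
    then show "n \<le> r" using y(1) vge_exact[OF r] by (auto simp: symbolic_power_eq)
  next
    assume "n \<le> r"
    show "P \<subseteq> symbolic_power Q n"
    proof
      fix p assume "p \<in> P"
      show "p \<in> symbolic_power Q n"
      proof (cases "p = 0")
        case True
        then show ?thesis by (simp add: symbolic_power_eq vge_zero)
      next
        case False
        then obtain m s' t' where m: "s' \<in> S - P" "t' \<in> S - P" "s' * p = y ^ m * t'"
          using y(2)[of p] \<open>p \<in> P\<close> P' by blast
        then have notin: "s' \<notin> Q" "t' \<notin> Q" using P by auto
        have "m \<noteq> 0"
        proof
          assume "m = 0"
          then have "t' \<in> P" using m P'(2)[OF \<open>p \<in> P\<close>, of s'] by simp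
          then show False using m by simp
        qed
        then have "n \<le> r * m" using \<open>n \<le> r\<close> by (cases m) auto
        then show ?thesis using vge_of_product[OF r m(3) notin] by (simp add: symbolic_power_eq)
      qed
    qed
  qed
  then show ?thesis unfolding ramification_index_def by (intro Greatest_equality) auto
qed

text \<open>The hypotheses are symmetric in \<open>Q1\<close> and \<open>Q2\<close>, so applying
  this inequality twice gives equality.\<close>

lemma ramification_index_mono:
  fixes c :: "complex \<Rightarrow> 'x::idom" and S :: "'x set"
  assumes c: "is_C_embedding c"
    and R: "fg_C_algebra c UNIV" "normal_domain (UNIV :: 'x set)"
    and S: "C_subalgebra c S" "fg_C_algebra c S" "normal_domain S"
    and A: "D_subalgebra c A" and cof: "graded_cofinite c A"
    and int: "A \<inter> range mult_op = mult_op ` S"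
    and P: "height_one_in S P"
    and Q1: "height_one_in UNIV Q1" "Q1 \<inter> S = P"
    and Q2: "height_one_in UNIV Q2" "Q2 \<inter> S = P"
  shows "ramification_index P Q2 \<le> ramification_index P Q1"
proof (rule ccontr)
  assume less: "\<not> ?thesis"
  interpret S: unital_subring S by (rule C_subalgebra_subring[OF c S(1)])
  obtain G where G: "finite G" "alg_gen c G = UNIV" using R(1) by (auto simp: fg_C_algebra_def)
  have noethR: "noetherian_set (UNIV :: 'x set)" using noetherian_alg_gen[OF c G(1)] G(2) by simp
  have noethS: "noetherian_set S" using noetherian_alg_gen[OF c] S(2) by (auto simp: fg_C_algebra_def)
  have primeP: "prime_in S P" using P by (simp add: height_one_in_def)
  then have PS: "P \<subseteq> S" by (simp add: prime_in_def ideal_in_def)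
  obtain y where y: "y \<in> P" "y \<noteq> 0"
    "\<And>f. f \<in> S \<Longrightarrow> f \<noteq> 0 \<Longrightarrow> \<exists>n. \<exists>s\<in>S - P. \<exists>t\<in>S - P. s * f = y ^ n * t"
    using S.height_one_uniformizer[OF noethS S(3) P] by blast
  obtain x1 where "uniformizer Q1 x1" using height_one_uniformizer_UNIV[OF noethR R(2) Q1(1)] .
  then interpret U1: uniformizer Q1 x1 .
  obtain x2 where "uniformizer Q2 x2" using height_one_uniformizer_UNIV[OF noethR R(2) Q2(1)] .
  then interpret U2: uniformizer Q2 x2 .
  obtain r1 s1 t1 where 1: "s1 * y = x1 ^ r1 * t1" "s1 \<notin> Q1" "t1 \<notin> Q1"
    using U1.decomp[OF y(2)] by blast
  obtain r2 s2 t2 where 2: "s2 * y = x2 ^ r2 * t2" "s2 \<notin> Q2" "t2 \<notin> Q2"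
    using U2.decomp[OF y(2)] by blast
  have "r1 < r2"
    using less U1.ramification_index_eq[OF primeP Q1(2) y(1,3) 1]
      U2.ramification_index_eq[OF primeP Q2(2) y(1,3) 2] by simp
  have "y \<in> Q1" using y(1) Q1(2) by blast
  then have "U1.vge 1 y" using U1.vge_1_iff by blast
  then have "1 \<le> r1" using U1.vge_exact[OF 1] by blast
  then obtain k1 where k1: "r1 = Suc k1" by (cases r1) auto
  obtain k2 where k2: "r2 = Suc k2" using \<open>r1 < r2\<close> by (cases r2) auto
  have yA: "mult_op y \<in> A" using int y(1) PS by blast
  \<comment> \<open>Symbols of positive order from \<open>A\<close> vanish along \<open>Q1\<close>
    at the differential of \<open>x1\<close>. Both primes can be compared because the symbol at the
    differential of \<open>y\<close> lies in \<open>S\<close>.\<close>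
  have symbol: "(ad x1 ^^ m) \<theta> 1 \<in> Q1" if \<theta>: "\<theta> \<in> A" "diffop_le c m \<theta>" "m > 0" for \<theta> m
  proof (rule U1.symbol_in_prime[OF c 1[unfolded k1] \<theta>(2)])
    define z where "z = (ad y ^^ m) \<theta> 1"
    have "z \<in> S"
      unfolding z_def using D_subalgebra_ad[OF c A yA \<theta>(1)] diffop_le_ad_pow[of c 0 m \<theta> y] \<theta>(2)
      by (intro order_zero_part[OF int]) auto
    show "U1.vge (k1 * m + 1) ((ad y ^^ m) \<theta> 1)"
    proof (cases "z = 0")
      case True
      then show ?thesis using U1.vge_zero by (simp add: z_def)
    next
      case False
      then obtain l s t where l: "s \<in> S - P" "t \<in> S - P" "s * z = y ^ l * t"
        using y(3) \<open>z \<in> S\<close> by blast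
      then have notin: "s \<notin> Q1" "t \<notin> Q1" "s \<notin> Q2" "t \<notin> Q2" using Q1 Q2 by auto
      have "U2.vge (k2 * m) z" unfolding z_def by (rule U2.vge_symbol[OF 2[unfolded k2] \<theta>(2)])
      then have le: "k2 * m \<le> r2 * l" using U2.vge_of_product[OF 2 l(3) notin(3,4)] by simp
      \<comment> \<open>The goal is \<open>r1 * l > (r1 - 1) * m\<close>. It is clear for
        \<open>m \<le> l\<close>; for \<open>m = l + Suc d\<close> the bound at \<open>Q2\<close>
        reads \<open>r2 * Suc d \<le> m\<close>, and \<open>r1 < r2\<close> gives the strict
        inequality \<open>r1 * Suc d < m\<close>.\<close>
      have "k1 * m + 1 \<le> r1 * l"
      proof (cases "m \<le> l")
        case True
        then have "r1 * m \<le> r1 * l" by simp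
        then show ?thesis using \<theta>(3) k1 by simp
      next
        case False
        then obtain d where d: "m = l + Suc d" using less_imp_Suc_add by fastforce
        have "r2 * Suc d \<le> m" using le unfolding k2 d by (simp add: algebra_simps)
        moreover have "r1 * Suc d < r2 * Suc d" using \<open>r1 < r2\<close> by (intro mult_strict_right_mono) auto
        ultimately have "r1 * Suc d < m" by simp
        then show ?thesis unfolding k1 d by (simp add: algebra_simps)
      qed
      then show ?thesis using U1.vge_of_product[OF 1 l(3) notin(1,2)] by (simp add: z_def)
    qed
  qed
  obtain \<delta> where \<delta>: "derivation_on UNIV \<delta>" "\<And>z. \<delta> (c z) = 0" "\<delta> x1 \<notin> Q1"
    using U1.transverse_derivation[OF c G] by blast
  obtain J :: "nat set" and s dj where J: "finite J" "\<forall>j\<in>J. diffop_le c (dj j) (s j)"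
    "\<forall>d \<theta>. diffop_le c d \<theta> \<longrightarrow> (\<exists>a. (\<forall>j\<in>J. a j \<in> A \<and> (dj j \<le> d \<longrightarrow> diffop_le c (d - dj j) (a j))
        \<and> (d < dj j \<longrightarrow> a j = (\<lambda>_. 0))) \<and> diffop_lt c d (\<lambda>g. \<theta> g - (\<Sum>j\<in>J. a j (s j g))))"
    using cof unfolding graded_cofinite_def by (elim exE conjE) (rule that)
  \<comment> \<open>\<open>n\<close> exceeds every \<open>dj j\<close>, so each coefficient
    \<open>a j\<close> is taken in positive degree \<open>n - dj j\<close>, where
    \<open>symbol\<close> applies.\<close>
  define n where "n = Suc (\<Sum>j\<in>J. dj j)"
  have dj: "dj j < n" if "j \<in> J" for j
    using member_le_sum[of j J dj] J(1) that by (simp add: n_def)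
  have \<delta>n: "diffop_le c n (\<delta> ^^ n)" "(ad x1 ^^ n) (\<delta> ^^ n) 1 = of_nat (fact n) * \<delta> x1 ^ n"
    using derivation_funpow_symbol[of \<delta> c n x1] \<delta>(1,2) by auto
  with J(3) obtain a where aJ: "\<forall>j\<in>J. a j \<in> A \<and> (dj j \<le> n \<longrightarrow> diffop_le c (n - dj j) (a j))
      \<and> (n < dj j \<longrightarrow> a j = (\<lambda>_. 0))"
    and lower: "diffop_lt c n (\<lambda>g. (\<delta> ^^ n) g - (\<Sum>j\<in>J. a j (s j g)))" by blast
  have a: "a j \<in> A" "diffop_le c (n - dj j) (a j)" if "j \<in> J" for j
    using bspec[OF aJ that] dj[OF that] by auto
  \<comment> \<open>The remainder has order below \<open>n\<close>, so \<open>n\<close> commutators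
    annihilate it.\<close>
  have "(ad x1 ^^ n) (\<lambda>g. (\<delta> ^^ n) g - (\<Sum>j\<in>J. a j (s j g))) = (\<lambda>_. 0)"
    using lower ad_pow_eq_0[of c "\<Sum>j\<in>J. dj j"] by (simp add: n_def diffop_lt_def)
  then have "of_nat (fact n) * \<delta> x1 ^ n = (\<Sum>j\<in>J. (ad x1 ^^ n) (\<lambda>g. a j (s j g)) 1)"
    unfolding ad_pow_diff ad_pow_sum \<delta>n(2)[symmetric] by (simp add: fun_eq_iff)
  also have "\<dots> \<in> Q1"
  proof (rule ideal_in_sum[OF U1.ideal])
    fix j assume j: "j \<in> J"
    have "(ad x1 ^^ n) (\<lambda>g. a j (s j g)) 1 =
        of_nat (n choose (n - dj j)) * ((ad x1 ^^ (n - dj j)) (a j) 1 * (ad x1 ^^ dj j) (s j) 1)"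
      using ad_pow_comp[OF a(2)[OF j] bspec[OF J(2) j], of x1] dj[OF j] by simp
    also have "\<dots> \<in> Q1"
      using symbol[OF a[OF j]] dj[OF j] by (intro U1.mult_mem_left U1.mult_mem_right) simp
    finally show "(ad x1 ^^ n) (\<lambda>g. a j (s j g)) 1 \<in> Q1" .
  qed
  finally have "of_nat (fact n) * \<delta> x1 ^ n \<in> Q1" .
  moreover have "\<delta> x1 ^ i \<notin> Q1" for i
    using \<delta>(3) by (induction i) (auto simp: U1.one_notin U1.mult_notin)
  moreover have "of_nat (fact n) \<notin> Q1" by (rule U1.unit_notin[OF c]) simp
  ultimately show False using U1.mult_notin by metis
qed

theorem theorem3p5:
  fixes c :: "complex \<Rightarrow> 'x::idom" and S :: "'x set" and A :: "('x \<Rightarrow> 'x) set"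
  assumes "is_C_embedding c"
    and "fg_C_algebra c UNIV" and "normal_domain (UNIV :: 'x set)"
    and "C_subalgebra c S" and "fg_C_algebra c S" and "normal_domain S"
    and "D_subalgebra c A" and "graded_cofinite c A"
    and "A \<inter> range mult_op = mult_op ` S"
  shows "uniformly_ramified S"
  unfolding uniformly_ramified_def
proof (intro conjI allI impI)
  have S: "unital_subring S" by (rule C_subalgebra_subring[OF assms(1,4)])
  show fin: "finite_morphism S"
    by (rule graded_cofinite_finite_morphism[OF assms(1) S assms(8,9)])
  obtain G where "finite G" "alg_gen c G = UNIV" using assms(2) by (auto simp: fg_C_algebra_def)
  then have "noetherian_set (UNIV :: 'x set)" using noetherian_alg_gen[OF assms(1)] by metis
  then show "surjective_morphism S" by (rule finite_morphism_surjective[OF S _ fin])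
next
  fix P Q1 Q2
  assume P: "height_one_in S P" and Q1: "height_one_in UNIV Q1" and Q2: "height_one_in UNIV Q2"
    and Q1S: "Q1 \<inter> S = P" and Q2S: "Q2 \<inter> S = P"
  show "ramification_index P Q1 = ramification_index P Q2"
    using ramification_index_mono[OF assms P Q1 Q1S Q2 Q2S]
      ramification_index_mono[OF assms P Q2 Q2S Q1 Q1S] by (rule antisym[rotated])
qed

end
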